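(* Let $f\geq 3$ and $\alpha\in\mathrm{GF}(2^f)$ be such that $\Gamma=\Gamma(f,\alpha)=\mathrm{Cos}(G,L,Lg_\alpha L)$ is connected, and let $A=G\times\langle\sigma\rangle$, $A^+=T^2\rtimes\langle\sigma\pi\rangle$, $G=T^2\rtimes\langle\pi\rangle$, $M=T^2\times\langle\sigma\rangle$ and $G^+=T^2$. Then $G$ is biquasiprimitive on $V\Gamma$, while $M$ and $A$ are not biquasiprimitive on $V\Gamma$; and $A^+$ is quasiprimitive on each bipartite half of $\Gamma$, while $G^+$ is not.
   Context: Let $T=\mathrm{PSL}(2,2^f)$, viewed as the group of permutations $t_{p,q,r,s}:x\mapsto \frac{px+q}{rx+s}$ of $\mathrm{GF}(2^f)\cup\{\infty\}$ with $p,q,r,s\in\mathrm{GF}(2^f)$, $ps-qr\neq0$ (usual conventions for $\infty$). Permutations act on the right, and $x^y=y^{-1}xy$. Put $a=t_{1,1,1,0}$, $b=t_{1,1,0,1}$ (so $\langle a,b\rangle=\mathrm{PSL}(2,2)\cong S_3$) and $u_\alpha=t_{1,\alpha,0,1}$ for $\alpha\in\mathrm{GF}(2^f)$. Let $G=T^2\rtimes\langle\pi\rangle$, where $\pi$ has order $2$ and $(x,y)^\pi=(y,x)$ for $(x,y)\in T^2$; let $L=\langle(a,a),(b,b)\rangle<T^2$ and $g_\alpha=(u_\alpha,bu_\alpha)\pi\in G$; then $Lg_\alpha L=Lg_\alpha^{-1}L$. For a group $X$, subgroup $Y$ and $g\in X$ with $YgY=Yg^{-1}Y$, the coset graph $\mathrm{Cos}(X,Y,YgY)$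 has as vertices the right cosets of $Y$ in $X$, with $Yx_1,Yx_2$ adjacent iff $x_2x_1^{-1}\in YgY$. $\Gamma(f,\alpha)=\mathrm{Cos}(G,L,Lg_\alpha L)$ is bipartite, with halves $\{Lx\mid x\in T^2\}$ and $\{Lx\mid x\in G\setminus T^2\}$. $G$ acts faithfully on it by right multiplication and is regarded as a subgroup of $\mathrm{Aut}(\Gamma)$. The map $\sigma:Lx\mapsto L\pi x$ ($x\in G$) is an automorphism of $\Gamma$ of order $2$ centralising $G$ and not in $G$. A transitive permutation group is quasiprimitive if all its nontrivial normal subgroups are transitive; it is biquasiprimitive if it is not quasiprimitive and all its nontrivial normal subgroups have at most two orbits. A group acting transitively on a set is quasiprimitive on it if the induced permutation group is quasiprimitive. "$G^+$ is not" means $G^+$ is quasiprimitive on neither half (its two actions being equivalent). *)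

theory Defs
  imports
    "HOL-Algebra.Group_Action"
    "HOL-Algebra.Generated_Groups"
    "Graph_Theory.Digraph_Component"
begin

section \<open>Permutation groups\<close>

text \<open>
  Permutations act on the right: the product of \<open>f\<close> and \<open>g\<close> is first \<open>f\<close>, then \<open>g\<close>
  (\<^const>\<open>BijGroup\<close> uses the opposite order). As in \<^const>\<open>Bij\<close>, permutations of \<open>\<Omega>\<close> are
  extensional functions.
\<close>

definition Sym :: "'v set \<Rightarrow> ('v \<Rightarrow> 'v) monoid" where
  "Sym \<Omega> = \<lparr>carrier = Bij \<Omega>, monoid.mult = (\<lambda>f g. compose \<Omega> g f), one = (\<lambda>x\<in>\<Omega>. x)\<rparr>"

text \<open>A permutation group on \<open>\<Omega>\<close> is given by its underlying set \<open>H\<close> of permutations.\<close>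

abbreviation perm_group :: "'v set \<Rightarrow> ('v \<Rightarrow> 'v) set \<Rightarrow> ('v \<Rightarrow> 'v) monoid" where
  "perm_group \<Omega> H \<equiv> (Sym \<Omega>)\<lparr>carrier := H\<rparr>"

definition transitive :: "'v set \<Rightarrow> ('v \<Rightarrow> 'v) set \<Rightarrow> bool" where
  "transitive \<Omega> H \<longleftrightarrow> (\<forall>x\<in>\<Omega>. \<forall>y\<in>\<Omega>. \<exists>h\<in>H. h x = y)"

definition transitive_perm_group :: "'v set \<Rightarrow> ('v \<Rightarrow> 'v) set \<Rightarrow> bool" where
  "transitive_perm_group \<Omega> H \<longleftrightarrow> subgroup H (Sym \<Omega>) \<and> transitive \<Omega> H"

definition at_most_two_orbits :: "'v set \<Rightarrow> ('v \<Rightarrow> 'v) set \<Rightarrow> bool" where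
  "at_most_two_orbits \<Omega> H \<longleftrightarrow>
     finite (orbits (perm_group \<Omega> H) \<Omega> (\<lambda>h. h)) \<and>
     card (orbits (perm_group \<Omega> H) \<Omega> (\<lambda>h. h)) \<le> 2"

definition quasiprimitive :: "'v set \<Rightarrow> ('v \<Rightarrow> 'v) set \<Rightarrow> bool" where
  "quasiprimitive \<Omega> H \<longleftrightarrow>
     transitive_perm_group \<Omega> H \<and>
     (\<forall>N. N \<lhd> perm_group \<Omega> H \<and> N \<noteq> {\<one>\<^bsub>Sym \<Omega>\<^esub>} \<longrightarrow> transitive \<Omega> N)"

definition biquasiprimitive :: "'v set \<Rightarrow> ('v \<Rightarrow> 'v) set \<Rightarrow> bool" where
  "biquasiprimitive \<Omega> H \<longleftrightarrow>
     transitive_perm_group \<Omega> H \<and>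
     \<not> quasiprimitive \<Omega> H \<and>
     (\<forall>N. N \<lhd> perm_group \<Omega> H \<and> N \<noteq> {\<one>\<^bsub>Sym \<Omega>\<^esub>} \<longrightarrow> at_most_two_orbits \<Omega> N)"

text \<open>
  The permutation group induced on an invariant subset \<open>\<Delta>\<close> by a group \<open>H\<close> of permutations of a
  larger set.
\<close>

definition induced :: "'v set \<Rightarrow> ('v \<Rightarrow> 'v) set \<Rightarrow> ('v \<Rightarrow> 'v) set" where
  "induced \<Delta> H = (\<lambda>h. restrict h \<Delta>) ` H"

section \<open>Coset graphs\<close>

text \<open>
  A graph is a symmetric digraph; the coset graph is symmetric when the double coset \<open>D\<close> is closed
  under inverses.
\<close>

definition double_coset :: "('x, 'm) monoid_scheme \<Rightarrow> 'x set \<Rightarrow> 'x \<Rightarrow> 'x set" where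
  "double_coset X Y g = (Y #>\<^bsub>X\<^esub> g) <#>\<^bsub>X\<^esub> Y"

definition Cos ::
    "('x, 'm) monoid_scheme \<Rightarrow> 'x set \<Rightarrow> 'x set \<Rightarrow> ('x set, 'x set \<times> 'x set) pre_digraph" where
  "Cos X Y D =
     \<lparr>verts = rcosets\<^bsub>X\<^esub> Y,
      arcs = {(Y #>\<^bsub>X\<^esub> x\<^sub>1, Y #>\<^bsub>X\<^esub> x\<^sub>2) | x\<^sub>1 x\<^sub>2.
                x\<^sub>1 \<in> carrier X \<and> x\<^sub>2 \<in> carrier X \<and> x\<^sub>2 \<otimes>\<^bsub>X\<^esub> inv\<^bsub>X\<^esub> x\<^sub>1 \<in> D},
      tail = fst, head = snd\<rparr>"

section \<open>The groups\<close>

text \<open>The projective line is \<^typ>\<open>'a option\<close>, where \<^term>\<open>None\<close> is the point at infinity.\<close>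

fun moebius :: "'a::field \<Rightarrow> 'a \<Rightarrow> 'a \<Rightarrow> 'a \<Rightarrow> 'a option \<Rightarrow> 'a option" where
  "moebius p q r s None = (if r = 0 then None else Some (p / r))"
| "moebius p q r s (Some x) =
     (if r * x + s = 0 then None else Some ((p * x + q) / (r * x + s)))"

text \<open>
  All linear fractional permutations are taken. This is \<open>PGL(2,q)\<close> in general, and equals
  \<open>PSL(2,q)\<close> for \<open>q\<close> even, the only case used.
\<close>

definition PSL2 :: "('a::field option \<Rightarrow> 'a option) monoid" where
  "PSL2 = perm_group UNIV {moebius p q r s | p q r s. p * s - q * r \<noteq> 0}"

text \<open>
  The semidirect product of \<open>S \<times> S\<close> with the group of order 2 generated by the swap \<open>\<pi>\<close>. The
  pair \<open>(n, e)\<close> stands for \<open>n\<pi>\<close> if \<open>e\<close> and for \<open>n\<close> otherwise; the multiplication uses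
  \<open>\<pi>n = n\<^sup>\<pi>\<pi>\<close>.
\<close>

definition wreath2 :: "('s, 'm) monoid_scheme \<Rightarrow> (('s \<times> 's) \<times> bool) monoid" where
  "wreath2 S =
     \<lparr>carrier = carrier (S \<times>\<times> S) \<times> UNIV,
      monoid.mult = (\<lambda>(n, e) (n', e'). (n \<otimes>\<^bsub>S \<times>\<times> S\<^esub> (if e then prod.swap n' else n'), e \<noteq> e')),
      one = (\<one>\<^bsub>S \<times>\<times> S\<^esub>, False)\<rparr>"

type_synonym 'a elt = "(('a option \<Rightarrow> 'a option) \<times> ('a option \<Rightarrow> 'a option)) \<times> bool"

definition GG :: "'a::field elt monoid" where
  "GG = wreath2 PSL2"

definition T2 :: "'a::field elt set" where
  "T2 = carrier (PSL2 \<times>\<times> PSL2) \<times> {False}"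

definition \<pi> :: "'a::field elt" where
  "\<pi> = (\<one>\<^bsub>PSL2 \<times>\<times> PSL2\<^esub>, True)"

definition perm_a :: "'a::field option \<Rightarrow> 'a option" where "perm_a = moebius 1 1 1 0"
definition perm_b :: "'a::field option \<Rightarrow> 'a option" where "perm_b = moebius 1 1 0 1"
definition perm_u :: "'a::field \<Rightarrow> 'a option \<Rightarrow> 'a option" where "perm_u \<alpha> = moebius 1 \<alpha> 0 1"

definition LL :: "'a::field elt set" where
  "LL = generate GG {((perm_a, perm_a), False), ((perm_b, perm_b), False)}"

definition g_elt :: "'a::field \<Rightarrow> 'a elt" where
  "g_elt \<alpha> = ((perm_u \<alpha>, perm_b \<otimes>\<^bsub>PSL2\<^esub> perm_u \<alpha>), False) \<otimes>\<^bsub>GG\<^esub> \<pi>"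

definition \<Gamma> :: "'a::field \<Rightarrow> ('a elt set, 'a elt set \<times> 'a elt set) pre_digraph" where
  "\<Gamma> \<alpha> = Cos GG LL (double_coset GG LL (g_elt \<alpha>))"

section \<open>Groups of permutations of the vertices\<close>

text \<open>
  The vertex set \<^term>\<open>VV\<close> of \<^term>\<open>\<Gamma> \<alpha>\<close> does not depend on \<open>\<alpha>\<close>.
  All groups below are subgroups of \<^term>\<open>Sym VV\<close>.
\<close>

definition VV :: "'a::field elt set set" where
  "VV = rcosets\<^bsub>GG\<^esub> LL"

definition halves :: "'a::field elt set set set" where
  "halves = {{LL #>\<^bsub>GG\<^esub> x | x. x \<in> T2}, {LL #>\<^bsub>GG\<^esub> x | x. x \<in> carrier GG - T2}}"

definition \<rho> :: "'a::field elt \<Rightarrow> 'a elt set \<Rightarrow> 'a elt set" where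
  "\<rho> x = (\<lambda>C\<in>VV. C #>\<^bsub>GG\<^esub> x)"

text \<open>
  \<open>\<sigma>\<close> maps \<open>Lx\<close> to \<open>L\<pi>x\<close>. As \<open>\<pi>\<close> normalises \<open>L\<close>, all sets in the union below coincide.
\<close>

definition \<sigma> :: "'a::field elt set \<Rightarrow> 'a elt set" where
  "\<sigma> = (\<lambda>C\<in>VV. \<Union>x\<in>C. LL #>\<^bsub>GG\<^esub> (\<pi> \<otimes>\<^bsub>GG\<^esub> x))"

definition Ghat :: "('a::field elt set \<Rightarrow> 'a elt set) set" where
  "Ghat = \<rho> ` carrier GG"

definition Gplus :: "('a::field elt set \<Rightarrow> 'a elt set) set" where
  "Gplus = \<rho> ` T2"

definition AA :: "('a::field elt set \<Rightarrow> 'a elt set) set" where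
  "AA = Ghat <#>\<^bsub>Sym VV\<^esub> generate (Sym VV) {\<sigma>}"

definition MM :: "('a::field elt set \<Rightarrow> 'a elt set) set" where
  "MM = Gplus <#>\<^bsub>Sym VV\<^esub> generate (Sym VV) {\<sigma>}"

definition Aplus :: "('a::field elt set \<Rightarrow> 'a elt set) set" where
  "Aplus = Gplus <#>\<^bsub>Sym VV\<^esub> generate (Sym VV) {\<sigma> \<otimes>\<^bsub>Sym VV\<^esub> \<rho> \<pi>}"

end

theory Submission
  imports Defs "HOL-Algebra.SimpleGroups" "HOL-Number_Theory.Residues"
begin

text \<open>
  As \<open>T\<close> is simple and non-abelian, every nontrivial normal subgroup of \<open>T\<^sup>2 \<rtimes> \<langle>\<pi>\<rangle>\<close> contains \<open>T\<^sup>2\<close>,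
  which is transitive on each half. Both \<open>G\<close> and \<open>A\<^sup>+\<close> are images of this abstract group, the
  latter because \<open>\<sigma>\<close> is a central involution; this gives the two positive statements. In \<open>M\<close> and
  \<open>A\<close> the central subgroup \<open>\<langle>\<sigma>\<rangle>\<close> has too many orbits, and the normal subgroup \<open>T \<times> 1\<close> of \<open>T\<^sup>2\<close> is
  intransitive on the halves since \<open>L\<close> is a proper subgroup of the diagonal.
\<close>

section \<open>Linear fractional permutations\<close>

text \<open>Simplicity of T is derived from matrix computations up to scalars. In characteristic 2
  squaring permutes a finite field, and f \<ge> 3 supplies \<kappa> outside {0, 1}. The same
  \<kappa> serves again to show that L is smaller than the diagonal.

  The halves are told apart by the bit \<open>snd\<close>, which is constant on cosets because L
  lies in T^2. Elements of G outside T^2 exchange the halves, and so does \<sigma>, which multiplies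
  on the left and therefore commutes with G. Correcting the outer elements by \<sigma> yields
  permutations that preserve each half; this is how A^+ arises, and nothing changes on T^2.
  Quasiprimitivity on a half thus reduces to the transitivity of T^2 there.\<close>

definition proj :: "'a::field \<Rightarrow> 'a \<Rightarrow> 'a option" where
  "proj x y = (if y = 0 then None else Some (x / y))"

lemma proj_cases:
  obtains x y :: "'a::field" where "z = proj x y" "x \<noteq> 0 \<or> y \<noteq> 0"
proof (cases z)
  case None
  then show ?thesis by (intro that[of 1 0]) (auto simp: proj_def)
next
  case (Some x)
  then show ?thesis by (intro that[of x 1]) (auto simp: proj_def)
qed

text \<open>In homogeneous coordinates infinity is no special point and a linear fractional map is
  multiplication by its matrix, so identities between such maps become identities between
  matrices.\<close>

lemma moebius_proj:
  assumes "x \<noteq> 0 \<or> y \<noteq> 0"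
  shows "moebius p q r s (proj x y) = proj (p * x + q * y) (r * x + s * y)"
proof (cases "y = 0")
  case True
  then show ?thesis using assms by (auto simp: proj_def)
next
  case False
  have "r * (x / y) + s = (r * x + s * y) / y" "p * (x / y) + q = (p * x + q * y) / y"
    using False by (simp_all add: field_simps)
  then show ?thesis using False by (simp add: proj_def)
qed

lemma matrix_kernel:
  fixes p q r s x y :: "'a::field"
  assumes "p * s - q * r \<noteq> 0" "x \<noteq> 0 \<or> y \<noteq> 0"
  shows "p * x + q * y \<noteq> 0 \<or> r * x + s * y \<noteq> 0"
proof (rule ccontr)
  assume "\<not> ?thesis"
  then have z: "p * x + q * y = 0" "r * x + s * y = 0" by auto
  \<comment> \<open>This is multiplication by the adjugate matrix.\<close>
  have "(p * s - q * r) * x = s * (p * x + q * y) - q * (r * x + s * y)"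
    "(p * s - q * r) * y = p * (r * x + s * y) - r * (p * x + q * y)"
    by (simp_all add: algebra_simps)
  then show False using assms unfolding z by simp
qed

text \<open>Invertibility of the inner matrix keeps the intermediate coordinate vector nonzero, so
  that \<open>moebius_proj\<close> applies a second time.\<close>

lemma moebius_comp:
  fixes p' :: "'a::field"
  assumes "p' * s' - q' * r' \<noteq> 0"
  shows "moebius p q r s \<circ> moebius p' q' r' s' =
    moebius (p * p' + q * r') (p * q' + q * s') (r * p' + s * r') (r * q' + s * s')"
proof
  fix z :: "'a option"
  obtain x y :: 'a where z: "z = proj x y" "x \<noteq> 0 \<or> y \<noteq> 0"
    by (rule proj_cases)
  show "(moebius p q r s \<circ> moebius p' q' r' s') z =
    moebius (p * p' + q * r') (p * q' + q * s') (r * p' + s * r') (r * q' + s * s') z"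
    by (simp add: z(1) moebius_proj[OF z(2)] moebius_proj[OF matrix_kernel[OF assms z(2)]]
        algebra_simps)
qed

lemma moebius_scale:
  fixes c :: "'a::field"
  assumes "c \<noteq> 0"
  shows "moebius (c * p) (c * q) (c * r) (c * s) = moebius p q r s"
proof
  fix z :: "'a option"
  obtain x y :: 'a where z: "z = proj x y" "x \<noteq> 0 \<or> y \<noteq> 0"
    by (rule proj_cases)
  have eq: "c * p * x + c * q * y = c * (p * x + q * y)" "c * r * x + c * s * y = c * (r * x + s * y)"
    by (simp_all add: algebra_simps)
  show "moebius (c * p) (c * q) (c * r) (c * s) z = moebius p q r s z"
    using assms by (simp only: z(1) moebius_proj[OF z(2)] eq) (simp add: proj_def)
qed

lemma moebius_scalar: "p \<noteq> 0 \<Longrightarrow> moebius p 0 0 p = id"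
proof
  fix z assume "p \<noteq> 0"
  then show "moebius p 0 0 p z = id z" by (cases z) auto
qed

lemma moebius_inverse:
  assumes "p * s - q * r \<noteq> 0"
  shows "moebius p q r s \<circ> moebius s (- q) (- r) p = id"
    "moebius s (- q) (- r) p \<circ> moebius p q r s = id"
  using assms moebius_scalar[of "p * s - q * r"]
  by (subst moebius_comp; simp add: algebra_simps)+

section \<open>The group T of linear fractional permutations\<close>

lemma carrier_PSL2: "carrier PSL2 = {moebius p q r s | p q r s. p * s - q * r \<noteq> 0}"
  by (simp add: PSL2_def)

lemma mult_PSL2 [simp]: "f \<otimes>\<^bsub>PSL2\<^esub> g = g \<circ> f"
  by (auto simp: PSL2_def Sym_def compose_def)

lemma one_PSL2 [simp]: "\<one>\<^bsub>PSL2\<^esub> = id"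
  by (auto simp: PSL2_def Sym_def)

lemma moebius_in_PSL2 [intro]: "p * s - q * r \<noteq> 0 \<Longrightarrow> moebius p q r s \<in> carrier PSL2"
  by (auto simp: carrier_PSL2)

lemma id_in_PSL2 [simp]: "id \<in> carrier PSL2"
  using moebius_in_PSL2[of 1 1 0 0] by (simp add: moebius_scalar)

lemma PSL2_cases:
  assumes "f \<in> carrier PSL2"
  obtains p q r s where "f = moebius p q r s" "p * s - q * r \<noteq> 0"
  using assms by (auto simp: carrier_PSL2)

lemma det_mult:
  fixes p :: "'a::field"
  shows "(p * p' + q * r') * (r * q' + s * s') - (p * q' + q * s') * (r * p' + s * r') =
    (p * s - q * r) * (p' * s' - q' * r')"
  by (simp add: algebra_simps)

lemma comp_in_PSL2: "f \<in> carrier PSL2 \<Longrightarrow> g \<in> carrier PSL2 \<Longrightarrow> f \<circ> g \<in> carrier PSL2"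
  by (elim PSL2_cases) (auto simp: moebius_comp det_mult intro!: moebius_in_PSL2)

lemma group_PSL2: "group PSL2"
proof (rule groupI)
  fix f :: "'a option \<Rightarrow> 'a option" assume "f \<in> carrier PSL2"
  then obtain p q r s where f: "f = moebius p q r s" "p * s - q * r \<noteq> 0"
    by (rule PSL2_cases)
  then have "moebius s (- q) (- r) p \<in> carrier PSL2"
    by (intro moebius_in_PSL2) (simp add: algebra_simps)
  then show "\<exists>g\<in>carrier PSL2. g \<otimes>\<^bsub>PSL2\<^esub> f = \<one>\<^bsub>PSL2\<^esub>"
    using f by (intro bexI[of _ "moebius s (- q) (- r) p"]) (simp_all add: moebius_inverse)
qed (simp_all add: comp_in_PSL2 id_in_PSL2 comp_assoc)

interpretation PSL2: group "PSL2 :: ('a::field option \<Rightarrow> 'a option) monoid"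
  by (rule group_PSL2)

lemma PSL2_inv_unique:
  assumes "f \<in> carrier PSL2" "g \<in> carrier PSL2" "f \<circ> g = id"
  shows "inv\<^bsub>PSL2\<^esub> f = g"
  using assms by (intro PSL2.inv_equality) auto

section \<open>Simplicity of T\<close>

lemma moebius_neq_id:
  assumes "moebius p q r s \<noteq> id" "p * s - q * r \<noteq> 0"
  shows "q \<noteq> 0 \<or> r \<noteq> 0 \<or> p \<noteq> s"
  using assms by (auto simp: moebius_scalar)

text \<open>Two commutators lead from any nontrivial element of a normal subgroup to a nontrivial
  translation. Its conjugates include all translations and their transforms under x -> 1/x, and
  these generate the group once square roots exist.\<close>

lemma simple_PSL2:
  fixes \<kappa> :: "'a::{field,finite}"
  assumes sq: "\<And>x::'a. \<exists>y. y\<^sup>2 = x"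
    and \<kappa>: "\<kappa> \<noteq> 0" "\<kappa>\<^sup>2 \<noteq> 1"
  shows "simple_group (PSL2 :: ('a option \<Rightarrow> 'a option) monoid)"
proof
  have "moebius 0 1 1 0 \<in> carrier (PSL2 :: ('a option \<Rightarrow> 'a option) monoid)"
    by (intro moebius_in_PSL2) simp
  moreover have "moebius 0 1 1 0 \<noteq> (id :: 'a option \<Rightarrow> 'a option)"
    by (metis id_apply moebius.simps(1) one_neq_zero option.distinct(1))
  ultimately have "{id, moebius 0 1 1 0} \<subseteq> carrier (PSL2 :: ('a option \<Rightarrow> 'a option) monoid)"
    "card {id, moebius 0 1 1 (0::'a)} = 2"
    using id_in_PSL2 by auto
  then show "1 < order (PSL2 :: ('a option \<Rightarrow> 'a option) monoid)"
    unfolding order_def by (metis card_mono finite one_less_numeral_iff order_less_le_trans semiring_norm(76))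
next
  fix N assume N: "N \<lhd> (PSL2 :: ('a option \<Rightarrow> 'a option) monoid)"
  have N_sub: "N \<subseteq> carrier PSL2" and id_N: "id \<in> N"
    using N PSL2.normal_invE(1) subgroup.subset subgroup.one_closed by fastforce+
  have comp: "f \<circ> g \<in> N" if "f \<in> N" "g \<in> N" for f g
    using subgroup.m_closed[OF PSL2.normal_invE(1)[OF N] that(2,1)] by simp
  have mult: "moebius (p * p' + q * r') (p * q' + q * s') (r * p' + s * r') (r * q' + s * s') \<in> N"
    if "moebius p q r s \<in> N" "moebius p' q' r' s' \<in> N" "p' * s' - q' * r' \<noteq> 0"
    for p q r s p' q' r' s'
    using comp[OF that(1,2)] that(3) by (simp add: moebius_comp)
  have inv: "moebius s (- q) (- r) p \<in> N" if "moebius p q r s \<in> N" "p * s - q * r \<noteq> 0" for p q r s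
  proof -
    have "inv\<^bsub>PSL2\<^esub> (moebius p q r s) = moebius s (- q) (- r) p"
      using that(2) by (intro PSL2_inv_unique moebius_in_PSL2 moebius_inverse) (simp_all add: algebra_simps)
    then show ?thesis
      using subgroup.m_inv_closed[OF PSL2.normal_invE(1)[OF N] that(1)] by simp
  qed
  have conj: "moebius ((a * p + b * r) * d - (a * q + b * s) * c) ((a * q + b * s) * a - (a * p + b * r) * b)
      ((c * p + d * r) * d - (c * q + d * s) * c) ((c * q + d * s) * a - (c * p + d * r) * b) \<in> N"
    if "moebius p q r s \<in> N" "p * s - q * r \<noteq> 0" "a * d - b * c \<noteq> 0" for a b c d p q r s
  proof -
    \<comment> \<open>Products in \<open>PSL2\<close> are read from left to right, so conjugating by
      the adjugate puts the matrix with entries a, b, c, d on the left of the matrix product. The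
      adjugate replaces the inverse to avoid division by the determinant.\<close>
    let ?g = "moebius d (- b) (- c) a"
    have g: "?g \<in> carrier PSL2" "moebius a b c d \<in> carrier PSL2"
      using that(3) by (auto simp: algebra_simps intro!: moebius_in_PSL2)
    have "inv\<^bsub>PSL2\<^esub> ?g = moebius a b c d"
      using that(3) g by (intro PSL2_inv_unique moebius_inverse)
    then have "moebius a b c d \<circ> (moebius p q r s \<circ> ?g) \<in> N"
      using PSL2.normal_invE(2)[OF N g(1) that(1)] by simp
    moreover have "moebius a b c d \<circ> (moebius p q r s \<circ> ?g) = (moebius a b c d \<circ> moebius p q r s) \<circ> ?g"
      by (simp add: comp_assoc)
    ultimately show ?thesis
      using that(2,3) by (simp add: moebius_comp algebra_simps)
  qed
  show "N = carrier PSL2 \<or> N = {\<one>\<^bsub>PSL2\<^esub>}"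
  proof (cases "N \<subseteq> {id}")
    case True
    then show ?thesis using id_N by auto
  next
    case False
    then obtain k where k0: "k \<in> N" "k \<noteq> id" by auto
    obtain p q r s where pq: "k = moebius p q r s" "p * s - q * r \<noteq> 0"
      by (rule PSL2_cases[of k]) (use N_sub k0 in auto)
    note k = k0[unfolded pq(1)] pq(2)
    \<comment> \<open>Some element of \<open>N\<close> moves infinity: an upper triangular one with
      q nonzero is conjugated by x -> 1/x, a diagonal one with p \<noteq> s by x -> x/(x +
      1).\<close>
    have "\<exists>p q r s. moebius p q r s \<in> N \<and> p * s - q * r \<noteq> 0 \<and> r \<noteq> 0"
    proof (cases "r = 0")
      case r: True
      show ?thesis
      proof (cases "q = 0")
        case False
        have "moebius (- s) 0 (- q) (- p) \<in> N"
          using conj[OF k(1,3), of 0 0 1 1] r by simp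
        then show ?thesis using k(3) r False by (intro exI conjI) (assumption, simp_all add: mult.commute)
      next
        case True
        then have "p - s \<noteq> 0" using moebius_neq_id[OF k(2,3)] r by simp
        moreover have "moebius p 0 (p - s) s \<in> N"
          using conj[OF k(1,3), of 1 1 0 1] r True by simp
        ultimately show ?thesis using k(3) r by (intro exI conjI) (assumption, simp_all)
      qed
    qed (use k in auto)
    then obtain p q r s where k: "moebius p q r s \<in> N" "p * s - q * r \<noteq> 0" "r \<noteq> 0"
      by auto
    \<comment> \<open>Conjugation by the translation that takes p/r, the image of infinity, to
      0.\<close>
    have "moebius 0 (q - p * s / r) r (s + p) \<in> N"
      using conj[OF k(1,2), of 1 1 "- (p / r)" 0] k(3) by simp
    moreover have "q - p * s / r \<noteq> 0" using k(2,3) by (simp add: field_simps)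
    ultimately have "\<exists>q r s. moebius 0 q r s \<in> N \<and> q \<noteq> 0 \<and> r \<noteq> 0" using k(3) by blast
    then obtain q r s where k: "moebius 0 q r s \<in> N" "q \<noteq> 0" "r \<noteq> 0" by auto
    \<comment> \<open>the commutator with \<open>x \<mapsto> \<kappa>x\<close> of an element mapping \<open>\<infinity>\<close> to \<open>0\<close> fixes \<open>0\<close>\<close>
    have "moebius s (- q) (- r) 0 \<in> N" using inv[OF k(1)] k(2,3) by simp
    from conj[OF this, of \<kappa> 1 0 0]
    have "moebius (\<kappa> * s) (- (\<kappa> * q * \<kappa>)) (- r) 0 \<in> N" using k \<kappa> by simp
    from mult[OF k(1) this] k \<kappa>
    have "moebius (- (q * r)) 0 (r * (\<kappa> * s) - s * r) (- (r * (\<kappa> * q * \<kappa>))) \<in> N" by simp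
    from conj[OF this, of 0 0 1 1]
    have m: "moebius (r * (\<kappa> * q * \<kappa>)) (- (r * (\<kappa> * s) - s * r)) 0 (q * r) \<in> N"
      using k \<kappa> by simp
    \<comment> \<open>The element is now the affine map x -> (D x + C)/A with multiplier D/A =
      \<open>\<kappa>\<^sup>2\<close>, which is not 1. Its commutator with x -> x + 1 is therefore a
      nontrivial translation.\<close>
    define D C A where "D = r * (\<kappa> * q * \<kappa>)" and "C = - (r * (\<kappa> * s) - s * r)" and "A = q * r"
    have "D = \<kappa>\<^sup>2 * A" by (simp add: D_def A_def power2_eq_square)
    then have nz: "A \<noteq> 0" "D \<noteq> 0" "D \<noteq> A" using k \<kappa> by (auto simp: A_def)
    have m: "moebius D C 0 A \<in> N" using m by (simp add: D_def C_def A_def)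
    from inv[OF this] nz have "moebius A (- C) 0 D \<in> N" by simp
    from conj[OF this, of 1 1 1 0] nz have "moebius A (D - C - A) 0 D \<in> N" by (simp add: algebra_simps)
    from mult[OF m this] nz
    have c: "moebius (A * D) (D * (D - A)) 0 (A * D) \<in> N" by (simp add: algebra_simps)
    define \<beta> where "\<beta> = (D - A) / A"
    have "moebius (A * D) (D * (D - A)) 0 (A * D) = moebius 1 \<beta> 0 1"
    proof -
      have "D * (D - A) = A * D * \<beta>" using nz by (simp add: \<beta>_def)
      then show ?thesis using nz moebius_scale[of "A * D" 1 \<beta> 0 1] by (simp add: ac_simps)
    qed
    with c have \<beta>: "moebius 1 \<beta> 0 1 \<in> N" "\<beta> \<noteq> 0" using nz by (simp_all add: \<beta>_def)
    have upper: "moebius 1 \<gamma> 0 1 \<in> N" for \<gamma>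
    proof (cases "\<gamma> = 0")
      case True
      then show ?thesis using id_N moebius_scalar[of "1::'a"] by simp
    next
      case False
      \<comment> \<open>Conjugation by the scaling x -> (\<gamma>/\<beta>) x; the adjugate leaves
        \<gamma>/\<beta> as a common factor of the entries.\<close>
      have "moebius (\<gamma> / \<beta>) ((\<gamma> / \<beta>) * \<gamma>) 0 (\<gamma> / \<beta>) \<in> N"
        using conj[OF \<beta>(1), of "\<gamma> / \<beta>" 1 0 0] \<beta>(2) False by simp
      then show ?thesis
        using moebius_scale[of "\<gamma> / \<beta>" 1 \<gamma> 0 1] False \<beta>(2) by simp
    qed
    have lower: "moebius 1 0 \<gamma> 1 \<in> N" for \<gamma>
      using conj[OF upper[of \<gamma>], of 0 0 1 1] moebius_scale[of "- 1" 1 0 \<gamma> 1] by simp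
    have flip: "moebius 0 \<delta> 1 0 \<in> N" if "\<delta> \<noteq> 0" for \<delta>
    proof -
      \<comment> \<open>The product of three unipotent matrices below has determinant 1 and gives
        the map sending x to -\<open>\<epsilon>\<^sup>2\<close>/x. To reach \<delta>/x, a root of
        -\<delta> is required; over a field with nonsquares the group would have the special
        projective group as a proper normal subgroup.\<close>
      obtain \<epsilon> where \<epsilon>: "\<epsilon>\<^sup>2 = - \<delta>" using sq by blast
      with that have "\<epsilon> \<noteq> 0" by auto
      from mult[OF mult[OF upper[of \<epsilon>] lower[of "- (1 / \<epsilon>)"]] upper[of \<epsilon>]] \<open>\<epsilon> \<noteq> 0\<close>
      have "moebius 0 \<epsilon> (- (1 / \<epsilon>)) 0 \<in> N" by simp
      moreover have "moebius 0 \<epsilon> (- (1 / \<epsilon>)) 0 = moebius 0 \<delta> 1 0"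
      proof -
        have "- (1 / \<epsilon>) * \<delta> = \<epsilon>"
          using \<epsilon> \<open>\<epsilon> \<noteq> 0\<close> by (simp add: power2_eq_square field_simps)
        then show ?thesis
          using moebius_scale[of "- (1 / \<epsilon>)" 0 \<delta> 1 0] \<open>\<epsilon> \<noteq> 0\<close> by simp
      qed
      ultimately show ?thesis by simp
    qed
    have big: "moebius p q r s \<in> N" if d: "p * s - q * r \<noteq> 0" and r: "r \<noteq> 0" for p q r s
    proof -
      \<comment> \<open>Bruhat decomposition: for r \<noteq> 0 the map is x -> p/r + \<delta>/(x +
        s/r).\<close>
      define \<delta> where "\<delta> = (q * r - p * s) / r\<^sup>2"
      have "\<delta> \<noteq> 0" using d r by (auto simp: \<delta>_def)
      from mult[OF mult[OF upper[of "p / r"] flip[OF this]] upper[of "s / r"]] \<open>\<delta> \<noteq> 0\<close>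
      have "moebius (p / r) (p / r * (s / r) + \<delta>) 1 (s / r) \<in> N" by simp
      moreover have "moebius (p / r) (p / r * (s / r) + \<delta>) 1 (s / r) = moebius p q r s"
        using moebius_scale[of r "p / r" "p / r * (s / r) + \<delta>" 1 "s / r"] r
        by (simp add: \<delta>_def power2_eq_square field_simps)
      ultimately show ?thesis by simp
    qed
    have "moebius p q r s \<in> N" if d: "p * s - q * r \<noteq> 0" for p q r s
    proof (cases "r = 0")
      case True
      \<comment> \<open>Composition with x -> 1/x exchanges the columns and so reduces r = 0 to the
        previous case.\<close>
      have "moebius q p s 0 \<in> N" using d True by (intro big) auto
      from mult[OF this flip[of 1]] True show ?thesis by simp
    qed (use big d in auto)
    then show ?thesis using N_sub by (auto simp: carrier_PSL2)
  qed
qed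

section \<open>Normal subgroups of the wreath product\<close>

lemma carrier_wreath2: "carrier (wreath2 S) = (carrier S \<times> carrier S) \<times> UNIV"
  by (simp add: wreath2_def)

lemma one_wreath2: "\<one>\<^bsub>wreath2 S\<^esub> = ((\<one>\<^bsub>S\<^esub>, \<one>\<^bsub>S\<^esub>), False)"
  by (simp add: wreath2_def)

lemma mult_wreath2:
  "((x, y), e) \<otimes>\<^bsub>wreath2 S\<^esub> ((x', y'), e') =
    (if e then (x \<otimes>\<^bsub>S\<^esub> y', y \<otimes>\<^bsub>S\<^esub> x') else (x \<otimes>\<^bsub>S\<^esub> x', y \<otimes>\<^bsub>S\<^esub> y'), e \<noteq> e')"
  by (simp add: wreath2_def)

lemmas wreath2_simps = carrier_wreath2 one_wreath2 mult_wreath2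

lemma group_wreath2:
  assumes "group S"
  shows "group (wreath2 S)"
proof -
  interpret S: group S by fact
  show ?thesis
  proof (rule groupI)
    fix u assume "u \<in> carrier (wreath2 S)"
    then obtain x y e where u: "u = ((x, y), e)" "x \<in> carrier S" "y \<in> carrier S"
      by (auto simp: carrier_wreath2)
    show "\<exists>v\<in>carrier (wreath2 S). v \<otimes>\<^bsub>wreath2 S\<^esub> u = \<one>\<^bsub>wreath2 S\<^esub>"
      using u by (intro bexI[of _ "(if e then (inv\<^bsub>S\<^esub> y, inv\<^bsub>S\<^esub> x) else (inv\<^bsub>S\<^esub> x, inv\<^bsub>S\<^esub> y), e)"])
        (auto simp: wreath2_simps)
  qed (auto simp: wreath2_simps S.m_assoc)
qed

lemma inv_wreath2:
  assumes "group S" "x \<in> carrier S" "y \<in> carrier S"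
  shows "inv\<^bsub>wreath2 S\<^esub> ((x, y), e) =
    (if e then (inv\<^bsub>S\<^esub> y, inv\<^bsub>S\<^esub> x) else (inv\<^bsub>S\<^esub> x, inv\<^bsub>S\<^esub> y), e)"
proof -
  interpret S: group S by fact
  interpret W: group "wreath2 S" by (rule group_wreath2) fact
  show ?thesis
    using assms by (intro W.inv_equality) (auto simp: wreath2_simps)
qed

text \<open>The centre \<open>Z\<close> is normal, hence trivial or everything, and in the latter
  case the group would be abelian.\<close>

lemma (in simple_group) not_central:
  assumes nc: "\<not> comm_group G" and x: "x \<in> carrier G" "x \<noteq> \<one>"
  shows "\<exists>t\<in>carrier G. x \<otimes> t \<noteq> t \<otimes> x"
proof (rule ccontr)
  define Z where "Z = {z \<in> carrier G. \<forall>t\<in>carrier G. z \<otimes> t = t \<otimes> z}"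
  assume "\<not> ?thesis"
  then have "x \<in> Z" using x by (auto simp: Z_def)
  have Z: "z \<in> carrier G" "t \<in> carrier G \<Longrightarrow> z \<otimes> t = t \<otimes> z" if "z \<in> Z" for z t
    using that by (auto simp: Z_def)
  have "subgroup Z G"
  proof (rule subgroupI)
    fix z assume "z \<in> Z"
    have "inv z \<otimes> t = t \<otimes> inv z" if "t \<in> carrier G" for t
      using arg_cong[OF Z(2)[OF \<open>z \<in> Z\<close>, of "inv t"], of "m_inv G"] Z(1)[OF \<open>z \<in> Z\<close>] that
      by (simp add: inv_mult_group)
    then show "inv z \<in> Z" using Z(1)[OF \<open>z \<in> Z\<close>] by (simp add: Z_def)
  next
    fix y z assume "y \<in> Z" "z \<in> Z"
    then have "y \<otimes> z \<otimes> t = t \<otimes> (y \<otimes> z)" if "t \<in> carrier G" for t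
      using Z that by (metis m_assoc)
    then show "y \<otimes> z \<in> Z"
      using Z(1)[OF \<open>y \<in> Z\<close>] Z(1)[OF \<open>z \<in> Z\<close>] by (simp add: Z_def)
  qed (use \<open>x \<in> Z\<close> in \<open>auto simp: Z_def\<close>)
  moreover have "t \<otimes> z \<otimes> inv t \<in> Z" if "t \<in> carrier G" "z \<in> Z" for t z
    using that Z(2)[OF \<open>z \<in> Z\<close> \<open>t \<in> carrier G\<close>, symmetric] Z(1)[OF \<open>z \<in> Z\<close>]
    by (simp add: m_assoc)
  ultimately have "Z \<lhd> G" by (simp add: normal_inv_iff)
  then have "Z = carrier G" using no_real_normal_subgroup \<open>x \<in> Z\<close> x(2) by blast
  then have "comm_group G"
    using Z by (intro group_comm_groupI) auto
  with nc show False by simp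
qed

text \<open>Commutators push a nontrivial element of \<open>N\<close> first into the base and then
  into one factor. There simplicity gives the whole factor, and conjugation by the swap gives the
  other one.\<close>

lemma normal_wreath2_contains_base:
  fixes S :: "('s, 'm) monoid_scheme"
  assumes simple: "simple_group S" and nc: "\<not> comm_group S"
    and N: "N \<lhd> wreath2 S" "N \<noteq> {\<one>\<^bsub>wreath2 S\<^esub>}"
  shows "(carrier S \<times> carrier S) \<times> {False} \<subseteq> N"
proof -
  interpret S: simple_group S by fact
  interpret W: group "wreath2 S" by (rule group_wreath2) unfold_locales
  interpret N: subgroup N "wreath2 S" using W.normal_invE[OF N(1)] by blast
  have closed: "u \<otimes>\<^bsub>wreath2 S\<^esub> v \<in> N" if "u \<in> N" "v \<in> N" for u v using that by simp
  have comm: "u \<otimes>\<^bsub>wreath2 S\<^esub> (v \<otimes>\<^bsub>wreath2 S\<^esub> inv\<^bsub>wreath2 S\<^esub> u \<otimes>\<^bsub>wreath2 S\<^esub> inv\<^bsub>wreath2 S\<^esub> v) \<in> N"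
    if "u \<in> N" "v \<in> carrier (wreath2 S)" for u v
    using that W.normal_invE(2)[OF N(1)] by simp
  have swap: "((y, x), False) \<in> N" if "((x, y), False) \<in> N" for x y
    using W.normal_invE(2)[OF N(1), of "((\<one>\<^bsub>S\<^esub>, \<one>\<^bsub>S\<^esub>), True)", OF _ that] N.mem_carrier[OF that]
    by (simp add: wreath2_simps inv_wreath2 S.is_group)
  obtain t\<^sub>0 where t\<^sub>0: "t\<^sub>0 \<in> carrier S" "t\<^sub>0 \<noteq> \<one>\<^bsub>S\<^esub>"
    using S.simple_not_triv S.one_closed by blast
  obtain x y e where u: "((x, y), e) \<in> N" "((x, y), e) \<noteq> \<one>\<^bsub>wreath2 S\<^esub>"
  proof -
    have "\<exists>u\<in>N. u \<noteq> \<one>\<^bsub>wreath2 S\<^esub>" using N(2) N.one_closed by blast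
    then show ?thesis using that by auto
  qed
  have xy: "x \<in> carrier S" "y \<in> carrier S" using N.mem_carrier[OF u(1)] by (auto simp: carrier_wreath2)
  have "\<exists>x y. ((x, y), False) \<in> N \<and> (x \<noteq> \<one>\<^bsub>S\<^esub> \<or> y \<noteq> \<one>\<^bsub>S\<^esub>)"
  proof (cases e)
    case False
    then show ?thesis using u by (auto simp: one_wreath2)
  next
    case True
    \<comment> \<open>An element outside the base moves the factor of \<open>(t\<^sub>0, 1)\<close>
      to the second coordinate, so the first coordinate of the commutator is just the inverse of
      \<open>t\<^sub>0\<close> and is nontrivial.\<close>
    have "((inv\<^bsub>S\<^esub> t\<^sub>0, y \<otimes>\<^bsub>S\<^esub> (t\<^sub>0 \<otimes>\<^bsub>S\<^esub> inv\<^bsub>S\<^esub> y)), False) \<in> N"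
      using comm[OF u(1), of "((t\<^sub>0, \<one>\<^bsub>S\<^esub>), False)"] True t\<^sub>0 xy
      by (simp add: wreath2_simps inv_wreath2 S.is_group S.m_assoc[symmetric])
    then show ?thesis using t\<^sub>0 S.inv_eq_1_iff by blast
  qed
  then obtain x y where xy: "((x, y), False) \<in> N" "x \<noteq> \<one>\<^bsub>S\<^esub>"
    using swap by blast
  then have cl: "x \<in> carrier S" "y \<in> carrier S" using N.mem_carrier[OF xy(1)] by (auto simp: carrier_wreath2)
  obtain t where t: "t \<in> carrier S" "x \<otimes>\<^bsub>S\<^esub> t \<noteq> t \<otimes>\<^bsub>S\<^esub> x"
    using S.not_central[OF nc cl(1) xy(2)] by blast
  \<comment> \<open>\<open>K\<close> is the part of \<open>N\<close> in the first factor. The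
    commutator of (x, y) with (t, 1) has second coordinate 1 whatever y is, and its first coordinate
    \<open>c\<close> is nontrivial because t does not commute with x.\<close>
  define K where "K = {k \<in> carrier S. ((k, \<one>\<^bsub>S\<^esub>), False) \<in> N}"
  define c where "c = x \<otimes>\<^bsub>S\<^esub> (t \<otimes>\<^bsub>S\<^esub> inv\<^bsub>S\<^esub> x \<otimes>\<^bsub>S\<^esub> inv\<^bsub>S\<^esub> t)"
  have "((c, \<one>\<^bsub>S\<^esub>), False) \<in> N"
    using comm[OF xy(1), of "((t, \<one>\<^bsub>S\<^esub>), False)"] t cl
    by (simp add: wreath2_simps inv_wreath2 S.is_group c_def)
  then have "c \<in> K" using t cl by (simp add: K_def c_def)
  have "c \<noteq> \<one>\<^bsub>S\<^esub>"
  proof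
    assume "c = \<one>\<^bsub>S\<^esub>"
    moreover have "c = (x \<otimes>\<^bsub>S\<^esub> t) \<otimes>\<^bsub>S\<^esub> inv\<^bsub>S\<^esub> (t \<otimes>\<^bsub>S\<^esub> x)"
      using t cl by (simp add: c_def S.m_assoc S.inv_mult_group)
    ultimately show False using t cl by (metis S.inv_closed S.inv_inv S.inv_equality S.m_closed)
  qed
  have "K \<lhd> S"
    unfolding S.normal_inv_iff
  proof (intro conjI ballI S.subgroupI)
    show "K \<noteq> {}" using \<open>c \<in> K\<close> by auto
    show "inv\<^bsub>S\<^esub> k \<in> K" if "k \<in> K" for k
      using that N.m_inv_closed[of "((k, \<one>\<^bsub>S\<^esub>), False)"] by (simp add: K_def inv_wreath2 S.is_group)
    show "k \<otimes>\<^bsub>S\<^esub> l \<in> K" if "k \<in> K" "l \<in> K" for k l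
      using that closed[of "((k, \<one>\<^bsub>S\<^esub>), False)" "((l, \<one>\<^bsub>S\<^esub>), False)"] by (simp add: K_def wreath2_simps)
    show "s \<otimes>\<^bsub>S\<^esub> k \<otimes>\<^bsub>S\<^esub> inv\<^bsub>S\<^esub> s \<in> K" if "s \<in> carrier S" "k \<in> K" for s k
      using that W.normal_invE(2)[OF N(1), of "((s, \<one>\<^bsub>S\<^esub>), False)" "((k, \<one>\<^bsub>S\<^esub>), False)"]
      by (simp add: K_def wreath2_simps inv_wreath2 S.is_group)
  qed (simp add: K_def)
  then have "K = carrier S"
    using S.no_real_normal_subgroup \<open>c \<in> K\<close> \<open>c \<noteq> \<one>\<^bsub>S\<^esub>\<close> by blast
  then have left: "((k, \<one>\<^bsub>S\<^esub>), False) \<in> N" if "k \<in> carrier S" for k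
    using that by (auto simp: K_def)
  have "((k, l), False) \<in> N" if "k \<in> carrier S" "l \<in> carrier S" for k l
    using that closed[OF left swap[OF left], of k l] by (simp add: wreath2_simps)
  then show ?thesis by auto
qed

section \<open>Symmetric groups, actions and homomorphic images\<close>

lemma carrier_Sym: "carrier (Sym \<Omega>) = Bij \<Omega>"
  by (simp add: Sym_def)

lemma mult_Sym: "f \<otimes>\<^bsub>Sym \<Omega>\<^esub> g = compose \<Omega> g f"
  by (simp add: Sym_def)

lemma one_Sym: "\<one>\<^bsub>Sym \<Omega>\<^esub> = (\<lambda>x\<in>\<Omega>. x)"
  by (simp add: Sym_def)

lemma compose_restrict_id: "f \<in> Bij \<Omega> \<Longrightarrow> compose \<Omega> f (\<lambda>x\<in>\<Omega>. x) = f"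
  by (auto simp: compose_def Bij_def extensional_def)

lemma group_Sym: "group (Sym \<Omega>)"
proof (rule groupI)
  fix f assume f: "f \<in> carrier (Sym \<Omega>)"
  then have "f \<otimes>\<^bsub>Sym \<Omega>\<^esub> (\<lambda>x\<in>\<Omega>. inv_into \<Omega> f x) = \<one>\<^bsub>Sym \<Omega>\<^esub>"
    by (simp add: carrier_Sym mult_Sym one_Sym Bij_compose_restrict_eq)
  moreover have "(\<lambda>x\<in>\<Omega>. inv_into \<Omega> f x) \<otimes>\<^bsub>Sym \<Omega>\<^esub> f = \<one>\<^bsub>Sym \<Omega>\<^esub>"
    using f by (auto simp: carrier_Sym mult_Sym one_Sym compose_def Bij_def bij_betw_def fun_eq_iff f_inv_into_f)
  ultimately show "\<exists>g\<in>carrier (Sym \<Omega>). g \<otimes>\<^bsub>Sym \<Omega>\<^esub> f = \<one>\<^bsub>Sym \<Omega>\<^esub>"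
    using f by (auto simp: carrier_Sym intro!: bexI[of _ "\<lambda>x\<in>\<Omega>. inv_into \<Omega> f x"] restrict_inv_into_Bij)
qed (auto simp: carrier_Sym mult_Sym one_Sym compose_Bij id_Bij Bij_imp_funcset Bij_imp_extensional
    compose_assoc [symmetric] compose_restrict_id)

text \<open>The inverse group element provides the inverse map. This yields both the coset action on
  all vertices and the twisted action on a half.\<close>

lemma action_hom_Sym:
  assumes X: "group X"
    and act: "\<And>x \<omega>. x \<in> carrier X \<Longrightarrow> \<omega> \<in> \<Omega> \<Longrightarrow> act x \<omega> \<in> \<Omega>"
    and one: "\<And>\<omega>. \<omega> \<in> \<Omega> \<Longrightarrow> act \<one>\<^bsub>X\<^esub> \<omega> = \<omega>"
    and mult: "\<And>x y \<omega>. x \<in> carrier X \<Longrightarrow> y \<in> carrier X \<Longrightarrow> \<omega> \<in> \<Omega> \<Longrightarrow> act (x \<otimes>\<^bsub>X\<^esub> y) \<omega> = act y (act x \<omega>)"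
  shows "group_hom X (Sym \<Omega>) (\<lambda>x. \<lambda>\<omega>\<in>\<Omega>. act x \<omega>)"
proof -
  interpret X: group X by fact
  have "(\<lambda>\<omega>\<in>\<Omega>. act x \<omega>) \<in> Bij \<Omega>" if x: "x \<in> carrier X" for x
  proof -
    have "bij_betw (act x) \<Omega> \<Omega>"
    proof (rule bij_betw_byWitness[where f' = "act (inv\<^bsub>X\<^esub> x)"])
      show "\<forall>\<omega>\<in>\<Omega>. act (inv\<^bsub>X\<^esub> x) (act x \<omega>) = \<omega>" "\<forall>\<omega>\<in>\<Omega>. act x (act (inv\<^bsub>X\<^esub> x) \<omega>) = \<omega>"
        using x by (simp_all add: one flip: mult)
    qed (use act x in auto)
    then show ?thesis by (simp add: Bij_def)
  qed
  then have "(\<lambda>x. \<lambda>\<omega>\<in>\<Omega>. act x \<omega>) \<in> hom X (Sym \<Omega>)"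
    by (intro homI) (auto simp: carrier_Sym mult_Sym compose_def mult act fun_eq_iff)
  then show ?thesis
    by (simp add: group_hom_def group_hom_axioms_def X group_Sym)
qed

text \<open>Reduces questions on normal subgroups of a permutation group to the abstract group that
  maps onto it: a nonidentity element of \<open>N\<close> has a nonidentity preimage.\<close>

lemma (in group_hom) nontrivial_normal_preimage:
  assumes N: "N \<lhd> H\<lparr>carrier := h ` carrier G\<rparr>" "N \<noteq> {\<one>\<^bsub>H\<^esub>}"
  shows "{x \<in> carrier G. h x \<in> N} \<lhd> G" "{x \<in> carrier G. h x \<in> N} \<noteq> {\<one>}"
proof -
  let ?H = "H\<lparr>carrier := h ` carrier G\<rparr>"
  interpret K: group ?H by (rule H.subgroup_imp_group[OF img_is_subgroup])
  interpret N: subgroup N ?H using K.normal_invE[OF N(1)] by blast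
  have inv: "inv\<^bsub>?H\<^esub> (h x) = h (inv x)" if "x \<in> carrier G" for x
    using that H.m_inv_consistent[OF img_is_subgroup] by simp
  have "h x \<otimes>\<^bsub>H\<^esub> h k \<otimes>\<^bsub>H\<^esub> h (inv x) \<in> N" if "x \<in> carrier G" "h k \<in> N" for x k
    using K.normal_invE(2)[OF N(1), of "h x" "h k"] that inv by simp
  moreover have "h (inv k) \<in> N" if "k \<in> carrier G" "h k \<in> N" for k
    using N.m_inv_closed[of "h k"] that inv by simp
  moreover have "h \<one> \<in> N" using N.one_closed by simp
  moreover have "h k \<otimes>\<^bsub>H\<^esub> h l \<in> N" if "h k \<in> N" "h l \<in> N" for k l
    using N.m_closed that by simp
  ultimately show "{x \<in> carrier G. h x \<in> N} \<lhd> G"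
    by (auto simp: G.normal_inv_iff intro!: G.subgroupI)
  have "N \<subseteq> h ` carrier G" "\<one>\<^bsub>H\<^esub> \<in> N" using N.subset N.one_closed by auto
  with N(2) obtain x where "x \<in> carrier G" "h x \<in> N" "h x \<noteq> \<one>\<^bsub>H\<^esub>" by blast
  then show "{x \<in> carrier G. h x \<in> N} \<noteq> {\<one>}" by (metis (mono_tags, lifting) hom_one mem_Collect_eq singletonD)
qed

section \<open>Extension by a central involution\<close>

lemma (in group) generate_involution:
  assumes "z \<in> carrier G" "z \<otimes> z = \<one>"
  shows "generate G {z} = {\<one>, z}"
proof
  have "inv z = z" using assms by (simp add: inv_equality)
  then have "subgroup {\<one>, z} G" using assms by (intro subgroupI) auto
  then show "generate G {z} \<subseteq> {\<one>, z}" by (intro generate_subgroup_incl) auto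
qed (auto intro: generate.intros)

lemma set_mult_pair:
  "H <#>\<^bsub>G\<^esub> {x, y} = (\<lambda>h. h \<otimes>\<^bsub>G\<^esub> x) ` H \<union> (\<lambda>h. h \<otimes>\<^bsub>G\<^esub> y) ` H"
  by (auto simp: set_mult_def)

text \<open>The product set is the union of \<open>H\<close> and its translate by \<open>z\<close>,
  and \<open>z\<close> commutes with every element of it. The lemma is meant for \<open>z\<close> =
  \<sigma>, with \<open>H\<close> the image of T^2 or of G.\<close>

lemma (in group) central_involution:
  assumes H: "subgroup H G" and z: "z \<in> carrier G" "z \<otimes> z = \<one>"
    and central: "\<And>h. h \<in> H \<Longrightarrow> h \<otimes> z = z \<otimes> h"
  shows "subgroup (H <#> {\<one>, z}) G" "{\<one>, z} \<lhd> G\<lparr>carrier := H <#> {\<one>, z}\<rparr>"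
proof -
  interpret H: subgroup H G by fact
  have inv_z: "inv z = z" using z by (simp add: inv_equality)
  have Z: "subgroup {\<one>, z} G" using z inv_z by (intro subgroupI) auto
  have eq: "H <#> {\<one>, z} = H \<union> (\<lambda>h. h \<otimes> z) ` H"
    using H.subset by (force simp: set_mult_pair)
  have zz: "a \<otimes> z \<otimes> z = a" if "a \<in> H" for a using that z by (simp add: m_assoc)
  have swap: "a \<otimes> z \<otimes> b = a \<otimes> b \<otimes> z" if "a \<in> H" "b \<in> H" for a b
    using that z central[OF that(2)] by (simp add: m_assoc)
  have inv: "inv (a \<otimes> z) = inv a \<otimes> z" if "a \<in> H" for a
    using that z central[of "inv a"] by (simp add: inv_mult_group inv_z)
  have mem: "a \<otimes> z \<in> H \<union> (\<lambda>h. h \<otimes> z) ` H" if "a \<in> H" for a using that by blast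
  show K: "subgroup (H <#> {\<one>, z}) G"
    unfolding eq
  proof (rule subgroupI)
    fix a assume "a \<in> H \<union> (\<lambda>h. h \<otimes> z) ` H"
    then show "inv a \<in> H \<union> (\<lambda>h. h \<otimes> z) ` H"
      using inv mem by auto
  next
    fix a b assume "a \<in> H \<union> (\<lambda>h. h \<otimes> z) ` H" "b \<in> H \<union> (\<lambda>h. h \<otimes> z) ` H"
    then obtain a' b' where ab: "a' \<in> H" "b' \<in> H" "a = a' \<or> a = a' \<otimes> z" "b = b' \<or> b = b' \<otimes> z" by blast
    have "a' \<otimes> (b' \<otimes> z) = a' \<otimes> b' \<otimes> z" "a' \<otimes> z \<otimes> (b' \<otimes> z) = a' \<otimes> b'"
      using ab(1,2) z swap[OF ab(1,2)] zz[of "a' \<otimes> b'"] by (simp_all flip: m_assoc)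
    then show "a \<otimes> b \<in> H \<union> (\<lambda>h. h \<otimes> z) ` H"
      using ab swap[OF ab(1,2)] mem[of "a' \<otimes> b'"] by (elim disjE) simp_all
  next
    show "H \<union> (\<lambda>h. h \<otimes> z) ` H \<noteq> {}" using H.one_closed by blast
  qed (use H.subset z in auto)
  let ?K = "G\<lparr>carrier := H <#> {\<one>, z}\<rparr>"
  interpret K: group ?K by (rule subgroup_imp_group[OF K])
  have sub: "{\<one>, z} \<subseteq> H <#> {\<one>, z}"
    using H.one_closed mem[OF H.one_closed] z by (simp add: eq)
  have "x \<otimes> z = z \<otimes> x" if x: "x \<in> H <#> {\<one>, z}" for x
  proof -
    obtain h where "h \<in> H" "x = h \<or> x = h \<otimes> z"
      using x by (auto simp: eq)
    then show ?thesis using central[of h] z by (auto simp: m_assoc)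
  qed
  then have "x \<otimes> k \<otimes> inv x \<in> {\<one>, z}" if "x \<in> H <#> {\<one>, z}" "k \<in> {\<one>, z}" for x k
    using that subgroup.mem_carrier[OF K that(1)] z by (auto simp: m_assoc)
  then show "{\<one>, z} \<lhd> ?K"
    using subgroup_incl[OF Z K sub] by (simp add: K.normal_inv_iff m_inv_consistent[OF K])
qed

lemma (in group_hom) normal_image:
  assumes "K \<lhd> G"
  shows "h ` K \<lhd> H\<lparr>carrier := h ` carrier G\<rparr>"
proof -
  have "group_hom G (H\<lparr>carrier := h ` carrier G\<rparr>) h"
    using induced_group_hom[OF G.subgroup_self] by simp
  then show ?thesis
    by (intro normal.surj_hom_normal_subgroup[OF assms]) simp_all
qed

section \<open>The actions on the vertices\<close>

lemma carrier_GG: "carrier GG = (carrier PSL2 \<times> carrier PSL2) \<times> UNIV"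
  by (simp add: GG_def carrier_wreath2)

lemma one_GG: "\<one>\<^bsub>GG\<^esub> = ((id, id), False)"
  by (simp add: GG_def one_wreath2)

lemma mult_GG:
  "((x, y), e) \<otimes>\<^bsub>GG\<^esub> ((x', y'), e') = (if e then (y' \<circ> x, x' \<circ> y) else (x' \<circ> x, y' \<circ> y), e \<noteq> e')"
  by (simp add: GG_def mult_wreath2)

lemma group_GG: "group GG"
  unfolding GG_def by (rule group_wreath2[OF group_PSL2])

interpretation GG: group "GG :: 'a::field elt monoid"
  by (rule group_GG)

lemma inv_GG:
  assumes "x \<in> carrier PSL2" "y \<in> carrier PSL2"
  shows "inv\<^bsub>GG\<^esub> ((x, y), e) =
    (if e then (inv\<^bsub>PSL2\<^esub> y, inv\<^bsub>PSL2\<^esub> x) else (inv\<^bsub>PSL2\<^esub> x, inv\<^bsub>PSL2\<^esub> y), e)"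
  unfolding GG_def by (rule inv_wreath2[OF group_PSL2 assms])

lemma snd_mult_GG: "snd (x \<otimes>\<^bsub>GG\<^esub> y) = (snd x \<noteq> snd y)"
  by (simp add: GG_def wreath2_def split_beta)

lemma snd_one_GG: "\<not> snd \<one>\<^bsub>GG\<^esub>"
  by (simp add: one_GG)

lemma snd_inv_GG: "x \<in> carrier GG \<Longrightarrow> snd (inv\<^bsub>GG\<^esub> x) = snd x"
  by (auto simp: carrier_GG inv_GG)

lemma T2_eq: "T2 = {x \<in> carrier GG. \<not> snd x}"
  by (auto simp: T2_def carrier_GG)

lemma subgroup_T2: "subgroup T2 GG"
proof (rule GG.subgroupI)
  have "\<one>\<^bsub>GG\<^esub> \<in> T2" by (simp add: T2_eq snd_one_GG)
  then show "T2 \<noteq> {}" by blast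
qed (auto simp: T2_eq snd_mult_GG snd_inv_GG)

lemma normal_T2: "T2 \<lhd> GG"
  unfolding GG.normal_inv_iff
  using subgroup_T2 by (auto simp: T2_eq snd_mult_GG snd_inv_GG)

lemma pi_eq: "\<pi> = ((id, id), True)"
  by (simp add: \<pi>_def)

lemma pi_closed [simp]: "\<pi> \<in> carrier GG"
  by (simp add: pi_eq carrier_GG)

lemma pi_pi: "\<pi> \<otimes>\<^bsub>GG\<^esub> \<pi> = \<one>\<^bsub>GG\<^esub>"
  by (simp add: pi_eq mult_GG one_GG)

lemma pi_pi_left: "x \<in> carrier GG \<Longrightarrow> \<pi> \<otimes>\<^bsub>GG\<^esub> (\<pi> \<otimes>\<^bsub>GG\<^esub> x) = x"
  by (simp add: pi_pi flip: GG.m_assoc)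

lemma snd_pi: "snd \<pi>"
  by (simp add: pi_eq)

section \<open>The vertex stabiliser L\<close>

lemma LL_gens:
  "{((perm_a, perm_a), False), ((perm_b, perm_b), False)} \<subseteq> carrier GG"
  by (auto simp: carrier_GG perm_a_def perm_b_def intro!: moebius_in_PSL2)

lemma perm_b_closed [simp]: "perm_b \<in> carrier PSL2"
  by (auto simp: perm_b_def intro!: moebius_in_PSL2)

lemma subgroup_LL: "subgroup LL GG"
  unfolding LL_def by (rule GG.generate_is_subgroup[OF LL_gens])

interpretation LL: subgroup LL "GG :: 'a::field elt monoid"
  by (rule subgroup_LL)

text \<open>The subgroup \<open>D\<close> is left open for two applications: the whole of T shows
  that L is diagonal, and the stabiliser of three points shows that L is not the full
  diagonal.\<close>

lemma LL_subset_diagonal: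
  assumes "subgroup D PSL2" "perm_a \<in> D" "perm_b \<in> D"
  shows "LL \<subseteq> (\<lambda>x. ((x, x), False)) ` D"
proof -
  interpret D: subgroup D PSL2 by fact
  have "subgroup ((\<lambda>x. ((x, x), False)) ` D) GG"
  proof (rule GG.subgroupI)
    fix u assume "u \<in> (\<lambda>x. ((x, x), False)) ` D"
    then show "inv\<^bsub>GG\<^esub> u \<in> (\<lambda>x. ((x, x), False)) ` D"
      using D.m_inv_closed D.mem_carrier by (auto simp: inv_GG)
  next
    fix u v assume "u \<in> (\<lambda>x. ((x, x), False)) ` D" "v \<in> (\<lambda>x. ((x, x), False)) ` D"
    then show "u \<otimes>\<^bsub>GG\<^esub> v \<in> (\<lambda>x. ((x, x), False)) ` D"
      using D.m_closed by (auto simp: mult_GG)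
  qed (use D.one_closed D.mem_carrier in \<open>auto simp: carrier_GG\<close>)
  then show ?thesis
    unfolding LL_def using assms(2,3) by (intro GG.generate_subgroup_incl) auto
qed

lemma LL_diag:
  assumes "u \<in> LL"
  obtains x where "x \<in> carrier PSL2" "u = ((x, x), False)"
  using LL_subset_diagonal[OF PSL2.subgroup_self] LL_gens assms by (auto simp: carrier_GG)

text \<open>\<open>L\<close> stabilises the projective line over the prime field, and \<open>x \<mapsto> x + \<kappa>\<close> does not.\<close>

lemma LL_proper:
  fixes \<kappa> :: "'a::field"
  assumes two: "(2::'a) = 0" and \<kappa>: "\<kappa> \<noteq> 0" "\<kappa> \<noteq> 1"
  shows "\<exists>s\<in>carrier PSL2. ((s, s), False) \<notin> (LL :: 'a elt set)"
proof
  let ?P = "{None, Some 0, Some (1::'a)}"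
  define D where "D = {x \<in> carrier PSL2. x ` ?P = ?P}"
  have two': "(1::'a) + 1 = 0" using two by simp
  have "subgroup D PSL2"
  proof (rule PSL2.subgroupI)
    fix x assume x: "x \<in> D"
    have "inv\<^bsub>PSL2\<^esub> x \<circ> x = id"
      using x PSL2.r_inv[of x] by (simp add: D_def)
    then have "(inv\<^bsub>PSL2\<^esub> x) ` (x ` ?P) = ?P"
      by (simp only: image_comp) simp
    moreover have "x ` ?P = ?P"
    proof -
      have "x \<in> carrier PSL2 \<and> x ` ?P = ?P" using x by (simp only: D_def mem_Collect_eq)
      then show ?thesis by (rule conjunct2)
    qed
    ultimately have "(inv\<^bsub>PSL2\<^esub> x) ` ?P = ?P" by (simp only:)
    moreover have "inv\<^bsub>PSL2\<^esub> x \<in> carrier PSL2" using x by (simp add: D_def)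
    ultimately show "inv\<^bsub>PSL2\<^esub> x \<in> D" unfolding D_def by (intro CollectI conjI)
  next
    fix x y assume xy: "x \<in> D" "y \<in> D"
    then have "(y \<circ> x) ` ?P = ?P" unfolding image_comp[symmetric] by (simp add: D_def)
    then show "x \<otimes>\<^bsub>PSL2\<^esub> y \<in> D" using xy by (simp add: D_def comp_in_PSL2)
  qed (use id_in_PSL2 in \<open>auto simp: D_def\<close>)
  \<comment> \<open>In characteristic 2, \<open>perm_a\<close> permutes infinity, 1, 0 cyclically,
    and \<open>perm_b\<close> fixes infinity and exchanges 0 and 1.\<close>
  moreover have "perm_a \<in> D" "perm_b \<in> D"
    using LL_gens two' by (auto simp: D_def carrier_GG perm_a_def perm_b_def)
  ultimately have "LL \<subseteq> (\<lambda>x. ((x, x), False)) ` D" by (rule LL_subset_diagonal)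
  moreover have "moebius 1 \<kappa> 0 1 \<notin> D" using \<kappa> by (auto simp: D_def)
  ultimately show "((moebius 1 \<kappa> 0 1, moebius 1 \<kappa> 0 1), False) \<notin> LL" by auto
  show "moebius 1 \<kappa> 0 1 \<in> carrier PSL2" by auto
qed

section \<open>Vertices as cosets and the permutations \<rho> and \<sigma>\<close>

abbreviation cs :: "'a::field elt \<Rightarrow> 'a elt set" where
  "cs x \<equiv> LL #>\<^bsub>GG\<^esub> x"

lemma cs_eq_iff:
  assumes "x \<in> carrier GG" "y \<in> carrier GG"
  shows "cs x = cs y \<longleftrightarrow> y \<otimes>\<^bsub>GG\<^esub> inv\<^bsub>GG\<^esub> x \<in> LL"
  by (metis assms GG.rcos_self GG.repr_independence LL.rcos_module group_GG subgroup_LL)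

text \<open>L lies in T^2, so multiplying by its elements does not change the bit. This separates
  the two halves.\<close>

lemma cs_snd:
  assumes "x \<in> carrier GG" "y \<in> carrier GG" "cs x = cs y"
  shows "snd x = snd y"
proof -
  have "y \<otimes>\<^bsub>GG\<^esub> inv\<^bsub>GG\<^esub> x \<in> LL" using assms by (simp add: cs_eq_iff)
  then have "\<not> snd (y \<otimes>\<^bsub>GG\<^esub> inv\<^bsub>GG\<^esub> x)" by (auto elim: LL_diag)
  then show ?thesis using assms by (simp add: snd_mult_GG snd_inv_GG)
qed

lemma VV_eq: "VV = cs ` carrier GG"
  by (auto simp: VV_def RCOSETS_def)

lemma cs_in_VV [simp]: "x \<in> carrier GG \<Longrightarrow> cs x \<in> VV"
  by (simp add: VV_eq)

lemma cs_mult: "x \<in> carrier GG \<Longrightarrow> y \<in> carrier GG \<Longrightarrow> cs x #>\<^bsub>GG\<^esub> y = cs (x \<otimes>\<^bsub>GG\<^esub> y)"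
  by (simp add: GG.coset_mult_assoc LL.subset)

lemma rho_cs: "x \<in> carrier GG \<Longrightarrow> y \<in> carrier GG \<Longrightarrow> \<rho> x (cs y) = cs (y \<otimes>\<^bsub>GG\<^esub> x)"
  by (simp add: \<rho>_def cs_mult)

lemma sigma_cs:
  assumes y: "y \<in> carrier GG"
  shows "\<sigma> (cs y) = cs (\<pi> \<otimes>\<^bsub>GG\<^esub> y)"
proof -
  have "cs (\<pi> \<otimes>\<^bsub>GG\<^esub> x) = cs (\<pi> \<otimes>\<^bsub>GG\<^esub> y)" if x: "x \<in> cs y" for x
  proof -
    obtain l where l: "l \<in> LL" "x = l \<otimes>\<^bsub>GG\<^esub> y" using x by (auto simp: r_coset_def)
    \<comment> \<open>Elements of L are diagonal, so the swap centralises them and every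
      representative of the coset contributes the same set to the union.\<close>
    have "\<pi> \<otimes>\<^bsub>GG\<^esub> l = l \<otimes>\<^bsub>GG\<^esub> \<pi>" using l(1) by (auto elim!: LL_diag simp: pi_eq mult_GG)
    then have "\<pi> \<otimes>\<^bsub>GG\<^esub> x = l \<otimes>\<^bsub>GG\<^esub> (\<pi> \<otimes>\<^bsub>GG\<^esub> y)"
      using l y LL.mem_carrier[OF l(1)] by (simp flip: GG.m_assoc)
    then show ?thesis
      using l y GG.repr_independence[OF _ _ subgroup_LL, of "\<pi> \<otimes>\<^bsub>GG\<^esub> x" "\<pi> \<otimes>\<^bsub>GG\<^esub> y"]
      by (simp add: GG.rcosI LL.subset)
  qed
  moreover have "cs y \<noteq> {}" using GG.rcos_self[OF y subgroup_LL] by auto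
  ultimately show ?thesis using y by (simp add: \<sigma>_def)
qed

lemma rho_hom: "group_hom GG (Sym VV) \<rho>"
proof -
  have "group_hom GG (Sym VV) (\<lambda>x. \<lambda>C\<in>VV. C #>\<^bsub>GG\<^esub> x)"
    by (rule action_hom_Sym[OF group_GG]) (auto simp: VV_eq cs_mult GG.m_assoc)
  then show ?thesis unfolding \<rho>_def .
qed

interpretation rho: group_hom GG "Sym VV" \<rho>
  by (rule rho_hom)

lemma sigma_closed [simp]: "\<sigma> \<in> carrier (Sym VV)"
proof -
  have "bij_betw \<sigma> VV VV"
    by (rule bij_betw_byWitness[where f' = \<sigma>]) (auto simp: VV_eq sigma_cs pi_pi_left)
  then show ?thesis by (auto simp: carrier_Sym Bij_def \<sigma>_def)
qed

lemma sigma_sigma: "\<sigma> \<otimes>\<^bsub>Sym VV\<^esub> \<sigma> = \<one>\<^bsub>Sym VV\<^esub>"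
  by (auto simp: mult_Sym one_Sym compose_def VV_eq sigma_cs pi_pi_left fun_eq_iff)

text \<open>\<sigma> multiplies on the left and \<rho> on the right, so this is
  associativity.\<close>

lemma sigma_central: "x \<in> carrier GG \<Longrightarrow> \<rho> x \<otimes>\<^bsub>Sym VV\<^esub> \<sigma> = \<sigma> \<otimes>\<^bsub>Sym VV\<^esub> \<rho> x"
  by (auto simp: mult_Sym compose_def VV_eq sigma_cs rho_cs GG.m_assoc fun_eq_iff)

text \<open>The embedding of \<open>G\<close> onto \<open>A\<^sup>+\<close> that sends \<open>\<pi>\<close> to \<open>\<sigma>\<pi>\<close>.\<close>

definition twist :: "'a::field elt \<Rightarrow> 'a elt set \<Rightarrow> 'a elt set" where
  "twist x = (if snd x then \<rho> x \<otimes>\<^bsub>Sym VV\<^esub> \<sigma> else \<rho> x)"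

lemma twist_cs:
  assumes "x \<in> carrier GG" "y \<in> carrier GG"
  shows "twist x (cs y) = cs (if snd x then \<pi> \<otimes>\<^bsub>GG\<^esub> (y \<otimes>\<^bsub>GG\<^esub> x) else y \<otimes>\<^bsub>GG\<^esub> x)"
  using assms by (simp add: twist_def mult_Sym compose_def rho_cs sigma_cs)

lemma twist_T2: "x \<in> T2 \<Longrightarrow> twist x = \<rho> x"
  by (simp add: twist_def T2_eq)

lemma Aplus_eq: "(Aplus :: ('a::field elt set \<Rightarrow> 'a elt set) set) = twist ` carrier GG"
proof -
  let ?\<tau> = "\<sigma> \<otimes>\<^bsub>Sym VV\<^esub> \<rho> (\<pi> :: 'a elt)"
  have \<tau>: "?\<tau> = \<rho> \<pi> \<otimes>\<^bsub>Sym VV\<^esub> \<sigma>" by (simp add: sigma_central)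
  \<comment> \<open>Writing the second factor in the opposite order brings the two copies of
    \<open>\<rho> \<pi>\<close> together, so that \<open>?\<tau>\<close> is seen to be an
    involution.\<close>
  have "?\<tau> \<otimes>\<^bsub>Sym VV\<^esub> ?\<tau> = ?\<tau> \<otimes>\<^bsub>Sym VV\<^esub> (\<rho> \<pi> \<otimes>\<^bsub>Sym VV\<^esub> \<sigma>)"
    by (rule arg_cong[OF \<tau>])
  also have "\<dots> = \<sigma> \<otimes>\<^bsub>Sym VV\<^esub> (\<rho> \<pi> \<otimes>\<^bsub>Sym VV\<^esub> \<rho> \<pi>) \<otimes>\<^bsub>Sym VV\<^esub> \<sigma>"
    by (simp add: rho.H.m_assoc)
  also have "\<rho> \<pi> \<otimes>\<^bsub>Sym VV\<^esub> \<rho> (\<pi> :: 'a elt) = \<one>\<^bsub>Sym VV\<^esub>"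
    by (simp add: pi_pi del: rho.hom_mult flip: rho.hom_mult)
  finally have "?\<tau> \<otimes>\<^bsub>Sym VV\<^esub> ?\<tau> = \<one>\<^bsub>Sym VV\<^esub>"
    by (simp add: sigma_sigma)
  then have gen: "generate (Sym VV) {?\<tau>} = {\<one>\<^bsub>Sym VV\<^esub>, ?\<tau>}"
    by (intro rho.H.generate_involution) auto
  have mult: "\<rho> t \<otimes>\<^bsub>Sym VV\<^esub> ?\<tau> = twist (t \<otimes>\<^bsub>GG\<^esub> \<pi>)" if "t \<in> T2" for t
    using that sigma_closed rho.hom_closed
    by (simp add: \<tau> T2_eq twist_def snd_mult_GG snd_pi rho.H.m_assoc)
  have "x = (x \<otimes>\<^bsub>GG\<^esub> \<pi>) \<otimes>\<^bsub>GG\<^esub> \<pi>" if "x \<in> carrier GG" for x :: "'a elt"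
    using that by (simp add: GG.m_assoc pi_pi)
  moreover have "x \<otimes>\<^bsub>GG\<^esub> \<pi> \<in> T2" if "x \<in> carrier GG" "snd x" for x :: "'a elt"
    using that by (simp add: T2_eq snd_mult_GG snd_pi)
  ultimately have "x \<in> T2 \<union> (\<lambda>t. t \<otimes>\<^bsub>GG\<^esub> \<pi>) ` T2" if "x \<in> carrier GG" for x :: "'a elt"
    using that by (cases "snd x") (blast, simp add: T2_eq)
  then have "carrier (GG :: 'a elt monoid) = T2 \<union> (\<lambda>t. t \<otimes>\<^bsub>GG\<^esub> \<pi>) ` T2"
    by (auto simp: T2_eq)
  then have "twist ` (carrier GG :: 'a elt set) = twist ` T2 \<union> (\<lambda>t. twist (t \<otimes>\<^bsub>GG\<^esub> \<pi>)) ` T2"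
    by (simp add: image_Un image_image)
  also have "\<dots> = \<rho> ` T2 \<union> (\<lambda>t. \<rho> t \<otimes>\<^bsub>Sym VV\<^esub> ?\<tau>) ` T2"
    by (simp add: mult twist_T2)
  also have "\<dots> = Aplus"
  proof -
    have "(\<lambda>t. \<rho> t \<otimes>\<^bsub>Sym VV\<^esub> \<one>\<^bsub>Sym VV\<^esub>) ` T2 = \<rho> ` (T2 :: 'a elt set)"
      using rho.hom_closed by (intro image_cong) (auto simp: T2_eq)
    then show ?thesis
      by (simp add: Aplus_def Gplus_def gen set_mult_pair image_image)
  qed
  finally show ?thesis by simp
qed

section \<open>The bipartite halves and transitivity\<close>

definition half :: "bool \<Rightarrow> 'a::field elt set set" where
  "half e = cs ` {x \<in> carrier GG. snd x = e}"

lemma halves_eq: "(halves :: 'a::field elt set set set) = range half"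
proof -
  have "T2 = {x \<in> carrier GG :: 'a elt set. snd x = False}"
    "carrier GG - T2 = {x \<in> carrier GG :: 'a elt set. snd x = True}"
    by (auto simp: T2_eq)
  then have "{cs x | x. x \<in> T2} = (half False :: 'a elt set set)"
    "{cs x | x. x \<in> carrier GG - T2} = (half True :: 'a elt set set)"
    by (simp_all only: half_def Setcompr_eq_image)
  then show ?thesis by (simp only: halves_def UNIV_bool image_insert image_empty)
qed

lemma VV_halves: "VV = half False \<union> half True"
  by (auto simp: VV_eq half_def)

lemma cs_in_half_iff: "x \<in> carrier GG \<Longrightarrow> cs x \<in> half e \<longleftrightarrow> snd x = e"
  by (auto simp: half_def dest: cs_snd)

text \<open>For x outside T^2, right multiplication by x and left multiplication by \<pi> both
  exchange the halves, so their composite preserves each. It is multiplicative because the left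
  factors \<pi> of two outer elements cancel.\<close>

lemma twist_half_hom:
  "group_hom GG (Sym (half e :: 'a::field elt set set)) (\<lambda>x. restrict (twist x) (half e))"
proof (rule action_hom_Sym[OF group_GG])
  fix x y :: "'a elt" and C :: "'a elt set"
  assume "x \<in> carrier GG" "y \<in> carrier GG" "C \<in> half e"
  then show "twist (x \<otimes>\<^bsub>GG\<^esub> y) C = twist y (twist x C)"
    by (auto simp: half_def twist_cs snd_mult_GG GG.m_assoc pi_pi_left)
qed (auto simp: half_def twist_cs snd_one_GG snd_mult_GG snd_pi cs_in_half_iff[unfolded half_def])

lemma Gplus_trans_half:
  fixes C D :: "'a::field elt set"
  assumes "C \<in> half e" "D \<in> half e"
  shows "\<exists>t\<in>T2. \<rho> t C = D"
proof -
  obtain x y where xy: "x \<in> carrier GG" "y \<in> carrier GG" "snd x = e" "snd y = e" "C = cs x" "D = cs y"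
    using assms by (auto simp: half_def)
  then have "inv\<^bsub>GG\<^esub> x \<otimes>\<^bsub>GG\<^esub> y \<in> T2" by (simp add: T2_eq snd_mult_GG snd_inv_GG)
  moreover have "\<rho> (inv\<^bsub>GG\<^esub> x \<otimes>\<^bsub>GG\<^esub> y) C = D"
    using xy by (simp add: rho_cs del: rho.hom_mult rho.hom_inv flip: GG.m_assoc)
  ultimately show ?thesis by blast
qed

lemma induced_Gplus_transitive:
  fixes H :: "('a::field elt set \<Rightarrow> 'a elt set) set"
  assumes "induced (half e) Gplus \<subseteq> H"
  shows "transitive (half e) H"
  unfolding transitive_def
proof (intro ballI)
  fix C D :: "'a elt set" assume CD: "C \<in> half e" "D \<in> half e"
  then obtain t where t: "t \<in> T2" "\<rho> t C = D" using Gplus_trans_half by blast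
  then have "restrict (\<rho> t) (half e) \<in> H" using assms by (auto simp: induced_def Gplus_def)
  then show "\<exists>h\<in>H. h C = D" using t CD by (intro bexI) auto
qed

text \<open>T^2 joins the vertices within each half, and \<open>h\<close> links the halves. The link
  is \<pi> in the case of G and \<sigma> in the cases of M and A.\<close>

lemma transitive_VV:
  fixes H :: "('a::field elt set \<Rightarrow> 'a elt set) set"
  assumes G: "Gplus \<subseteq> H" and h: "h \<in> H" "h ` half False \<subseteq> half True"
    and H: "subgroup H (Sym VV)"
  shows "transitive VV H"
proof -
  interpret H: subgroup H "Sym VV" by fact
  let ?b = "cs \<one>\<^bsub>GG\<^esub> :: 'a elt set"
  have b: "?b \<in> half False" by (simp add: half_def snd_one_GG)
  have bV: "?b \<in> VV" using b VV_halves by auto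
  have from_b: "\<exists>k\<in>H. k ?b = C" if C: "C \<in> VV" for C :: "'a elt set"
  proof (cases "C \<in> half False")
    case True
    then obtain t where "t \<in> T2" "\<rho> t ?b = C" using Gplus_trans_half[OF b] by blast
    then show ?thesis using G unfolding Gplus_def by blast
  next
    case False
    then have "C \<in> half True" using C VV_halves by auto
    moreover have "h ?b \<in> half True" using h b by auto
    ultimately obtain t where t: "t \<in> T2" "\<rho> t (h ?b) = C"
      using Gplus_trans_half by blast
    then have "h \<otimes>\<^bsub>Sym VV\<^esub> \<rho> t \<in> H" using h G by (auto simp: Gplus_def)
    moreover have "(h \<otimes>\<^bsub>Sym VV\<^esub> \<rho> t) ?b = C"
      using t bV by (simp add: mult_Sym compose_def)
    ultimately show ?thesis by blast
  qed
  show ?thesis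
    unfolding transitive_def
  proof (intro ballI)
    fix C D :: "'a elt set" assume CD: "C \<in> VV" "D \<in> VV"
    obtain k l where kl: "k \<in> H" "k ?b = C" "l \<in> H" "l ?b = D"
      using from_b CD by meson
    have "inv\<^bsub>Sym VV\<^esub> k \<otimes>\<^bsub>Sym VV\<^esub> l \<in> H" using kl by simp
    moreover have "(inv\<^bsub>Sym VV\<^esub> k \<otimes>\<^bsub>Sym VV\<^esub> l) C = D"
    proof -
      have "k \<otimes>\<^bsub>Sym VV\<^esub> inv\<^bsub>Sym VV\<^esub> k = \<one>\<^bsub>Sym VV\<^esub>" using H.mem_carrier[OF kl(1)] by (rule rho.H.r_inv)
      from fun_cong[OF this, of ?b] have "(inv\<^bsub>Sym VV\<^esub> k) C = ?b"
        using bV kl by (simp add: mult_Sym one_Sym compose_def)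
      then show ?thesis using CD kl by (simp add: mult_Sym compose_def)
    qed
    ultimately show "\<exists>h\<in>H. h C = D" by blast
  qed
qed

section \<open>Nontrivial normal subgroups contain T^2\<close>

lemma not_comm_PSL2: "\<not> comm_group (PSL2 :: ('a::field option \<Rightarrow> 'a option) monoid)"
proof
  assume "comm_group (PSL2 :: ('a option \<Rightarrow> 'a option) monoid)"
  then interpret P: comm_group "PSL2 :: ('a option \<Rightarrow> 'a option) monoid" .
  have "moebius 0 1 1 0 \<circ> moebius 1 1 0 1 = (moebius 1 1 0 1 \<circ> moebius 0 1 1 0 :: 'a option \<Rightarrow> 'a option)"
    using P.m_comm[of "moebius 1 1 0 1" "moebius 0 1 1 0"] by (simp add: moebius_in_PSL2)
  \<comment> \<open>One product sends infinity to 0, the other sends it to 1.\<close>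
  from fun_cong[OF this, of None] show False by simp
qed

text \<open>Stated for an arbitrary homomorphism from G, so that one argument covers
  \<open>\<rho>\<close> on all vertices and \<open>twist\<close> on a half.\<close>

lemma normal_contains_T2:
  fixes h :: "'a::field elt \<Rightarrow> 'b"
  assumes h: "group_hom GG H h" and simple: "simple_group (PSL2 :: ('a option \<Rightarrow> 'a option) monoid)"
    and N: "N \<lhd> H\<lparr>carrier := h ` carrier GG\<rparr>" "N \<noteq> {\<one>\<^bsub>H\<^esub>}"
  shows "h ` T2 \<subseteq> N"
  using normal_wreath2_contains_base[OF simple not_comm_PSL2, folded GG_def,
      OF group_hom.nontrivial_normal_preimage[OF h N]]
  by (auto simp: T2_def)

lemma Aplus_quasiprimitive:
  assumes "simple_group (PSL2 :: ('a::field option \<Rightarrow> 'a option) monoid)"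
  shows "quasiprimitive (half e :: 'a elt set set) (induced (half e) Aplus)"
proof -
  let ?h = "\<lambda>x. restrict (twist x) (half e :: 'a elt set set)"
  interpret h: group_hom GG "Sym (half e :: 'a elt set set)" ?h by (rule twist_half_hom)
  have A: "induced (half e) Aplus = ?h ` carrier GG"
    by (simp add: induced_def Aplus_eq image_image)
  have G: "induced (half e) Gplus = ?h ` T2"
    by (simp add: induced_def Gplus_def image_image twist_T2)
  have "subgroup (?h ` carrier GG) (Sym (half e))" by (rule h.img_is_subgroup)
  moreover have "transitive (half e) (?h ` carrier GG)"
    by (rule induced_Gplus_transitive) (auto simp: G T2_eq)
  moreover have "transitive (half e) N"
    if "N \<lhd> perm_group (half e) (?h ` carrier GG)" "N \<noteq> {\<one>\<^bsub>Sym (half e)\<^esub>}" for N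
    using normal_contains_T2[OF twist_half_hom assms that]
    by (intro induced_Gplus_transitive) (simp add: G)
  ultimately show ?thesis
    by (simp add: quasiprimitive_def transitive_perm_group_def A)
qed

section \<open>Biquasiprimitivity on the vertices: G, M and A\<close>

lemma rho_pi_half: "\<rho> \<pi> ` half False \<subseteq> half True"
  by (auto simp: half_def rho_cs snd_mult_GG snd_pi)

lemma sigma_half: "\<sigma> ` half False \<subseteq> half True"
  by (auto simp: half_def sigma_cs snd_mult_GG snd_pi)

lemma Ghat_transitive: "transitive_perm_group VV Ghat"
  unfolding transitive_perm_group_def
proof
  show sub: "subgroup Ghat (Sym VV)"
    unfolding Ghat_def by (rule rho.img_is_subgroup)
  show "transitive VV Ghat"
    by (rule transitive_VV[OF _ _ rho_pi_half sub]) (auto simp: Gplus_def Ghat_def T2_eq)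
qed

text \<open>A diagonal element with one trivial coordinate is trivial, so L meets T x 1 only in the
  identity. This supplies as many distinct vertices in one half as T has elements.\<close>

lemma cs_left_eq_iff:
  assumes "s \<in> carrier PSL2" "t \<in> carrier PSL2"
  shows "cs ((s, id), False) = cs ((t, id), False) \<longleftrightarrow> s = t"
proof
  assume "cs ((s, id), False) = cs ((t, id), False)"
  then have "((t, id), False) \<otimes>\<^bsub>GG\<^esub> inv\<^bsub>GG\<^esub> ((s, id), False) \<in> LL"
    using assms id_in_PSL2 by (subst (asm) cs_eq_iff) (auto simp: carrier_GG)
  then have "inv\<^bsub>PSL2\<^esub> s \<circ> t = inv\<^bsub>PSL2\<^esub> id \<circ> id"
    using assms id_in_PSL2 by (auto simp: inv_GG mult_GG elim!: LL_diag)
  moreover have "inv\<^bsub>PSL2\<^esub> id = id"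
    using PSL2.inv_one by simp
  ultimately have "t \<otimes>\<^bsub>PSL2\<^esub> inv\<^bsub>PSL2\<^esub> s = \<one>\<^bsub>PSL2\<^esub>" by simp
  then show "s = t" using assms by (metis PSL2.inv_closed PSL2.inv_equality PSL2.inv_inv)
qed simp

lemma perm_b_neq_id: "perm_b \<noteq> (id :: 'a::field option \<Rightarrow> 'a option)"
proof
  assume "perm_b = (id :: 'a option \<Rightarrow> 'a option)"
  from fun_cong[OF this, of "Some 0"] show False by (simp add: perm_b_def)
qed

lemma Gplus_nontrivial: "Gplus \<noteq> {\<one>\<^bsub>Sym (VV :: 'a::field elt set set)\<^esub>}"
proof
  assume eq: "Gplus = {\<one>\<^bsub>Sym (VV :: 'a elt set set)\<^esub>}"
  have "((perm_b, id), False) \<in> (T2 :: 'a elt set)" by (auto simp: T2_eq carrier_GG)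
  then have "\<rho> ((perm_b, id), False) = \<one>\<^bsub>Sym (VV :: 'a elt set set)\<^esub>" using eq by (auto simp: Gplus_def)
  then have "\<rho> ((perm_b, id), False) (cs (\<one>\<^bsub>GG\<^esub> :: 'a elt)) = cs \<one>\<^bsub>GG\<^esub>"
    by (simp add: one_Sym)
  then have "cs ((perm_b, id), False) = cs (\<one>\<^bsub>GG\<^esub> :: 'a elt)"
    using \<open>((perm_b, id), False) \<in> T2\<close> by (simp add: rho_cs T2_eq)
  then have "cs ((perm_b, id), False) = (cs ((id, id), False) :: 'a elt set)"
    by (simp add: one_GG)
  then show False using perm_b_neq_id[where 'a = 'a] by (simp add: cs_left_eq_iff)
qed

lemma Ghat_biquasiprimitive:
  assumes "simple_group (PSL2 :: ('a::field option \<Rightarrow> 'a option) monoid)"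
  shows "biquasiprimitive (VV :: 'a elt set set) Ghat"
  unfolding biquasiprimitive_def
proof (intro conjI allI impI)
  show "transitive_perm_group (VV :: 'a elt set set) Ghat" by (rule Ghat_transitive)
  \<comment> \<open>T^2 is the nontrivial normal subgroup that refutes quasiprimitivity: it cannot
    take the coset of the identity to that of \<pi>.\<close>
  have "Gplus \<lhd> perm_group VV Ghat"
    unfolding Gplus_def Ghat_def by (rule rho.normal_image[OF normal_T2])
  moreover have "\<not> transitive (VV :: 'a elt set set) Gplus"
  proof
    assume "transitive (VV :: 'a elt set set) Gplus"
    then have "\<exists>h\<in>Gplus. h (cs \<one>\<^bsub>GG\<^esub>) = cs (\<pi> :: 'a elt)"
      unfolding transitive_def using cs_in_VV[OF GG.one_closed] cs_in_VV[OF pi_closed] by blast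
    then obtain t :: "'a elt" where t: "t \<in> T2" "\<rho> t (cs \<one>\<^bsub>GG\<^esub>) = cs \<pi>"
      unfolding Gplus_def by blast
    then have "cs t = cs \<pi>" by (simp add: rho_cs T2_eq)
    then show False using t cs_snd[of t \<pi>] by (simp add: T2_eq snd_pi)
  qed
  ultimately show "\<not> quasiprimitive (VV :: 'a elt set set) Ghat"
    using Gplus_nontrivial by (auto simp: quasiprimitive_def)
next
  fix N :: "('a elt set \<Rightarrow> 'a elt set) set"
  assume N: "N \<lhd> perm_group VV Ghat \<and> N \<noteq> {\<one>\<^bsub>Sym VV\<^esub>}"
  then have sub: "Gplus \<subseteq> N"
    unfolding Gplus_def Ghat_def by (intro normal_contains_T2[OF rho_hom assms]) auto
  interpret N: subgroup N "perm_group VV Ghat"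
    using N normal_imp_subgroup by blast
  let ?orb = "orbit (perm_group VV N) (\<lambda>h. h) :: 'a elt set \<Rightarrow> 'a elt set set"
  \<comment> \<open>As \<open>N\<close> contains the image of T^2, vertices of the same half have
    the same orbit under \<open>N\<close>. Hence every orbit is that of the coset of the identity or
    of \<pi>.\<close>
  have mono: "?orb D \<subseteq> ?orb C" if "C \<in> half e" "D \<in> half e" for C D e
  proof
    fix E assume "E \<in> ?orb D"
    then obtain n where n: "n \<in> N" "E = n D" by (auto simp: orbit_def)
    obtain t where t: "t \<in> T2" "\<rho> t C = D" using Gplus_trans_half[OF \<open>C \<in> half e\<close> \<open>D \<in> half e\<close>] by blast
    then have "\<rho> t \<otimes>\<^bsub>Sym VV\<^esub> n \<in> N" using sub n N.m_closed[of "\<rho> t" n] by (auto simp: Gplus_def)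
    moreover have "(\<rho> t \<otimes>\<^bsub>Sym VV\<^esub> n) C = E"
      using that VV_halves t n by (cases e) (auto simp: mult_Sym compose_def)
    ultimately show "E \<in> ?orb C" by (auto simp: orbit_def)
  qed
  have half: "?orb C = ?orb (cs x)" if "C \<in> half e" "cs x \<in> half e" for C x e
    using mono[OF that] mono[OF that(2,1)] by auto
  have "cs \<one>\<^bsub>GG\<^esub> \<in> half False" "cs \<pi> \<in> half True"
    by (auto simp: cs_in_half_iff snd_one_GG snd_pi)
  then have "?orb C \<in> {?orb (cs \<one>\<^bsub>GG\<^esub>), ?orb (cs \<pi>)}" if "C \<in> VV" for C
    using half that unfolding VV_halves by blast
  then have sub2: "orbits (perm_group VV N) VV (\<lambda>h. h) \<subseteq> {?orb (cs \<one>\<^bsub>GG\<^esub>), ?orb (cs \<pi>)}"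
    unfolding orbits_def by blast
  then show "at_most_two_orbits VV N"
    unfolding at_most_two_orbits_def
    using finite_subset[OF sub2] card_mono[OF _ sub2] card_insert_le_m1[of 2 "{?orb (cs \<pi>)}" "?orb (cs \<one>\<^bsub>GG\<^esub>)"]
    by auto
qed

text \<open>\<sigma> exchanges the halves, so an orbit has only one vertex in each half, and three
  vertices of one half lie in three orbits.\<close>

lemma sigma_many_orbits: "\<not> at_most_two_orbits (VV :: 'a::field elt set set) {\<one>\<^bsub>Sym VV\<^esub>, \<sigma>}"
proof
  let ?O = "orbits (perm_group (VV :: 'a elt set set) {\<one>\<^bsub>Sym VV\<^esub>, \<sigma>}) VV (\<lambda>h. h)"
  let ?v = "\<lambda>t. cs ((t, id), False) :: 'a elt set"
  \<comment> \<open>These maps are distinct because they send 0 to 0, 1 and infinity.\<close>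
  let ?T = "{id, perm_b, moebius 0 1 1 0} :: ('a option \<Rightarrow> 'a option) set"
  assume "at_most_two_orbits (VV :: 'a elt set set) {\<one>\<^bsub>Sym VV\<^esub>, \<sigma>}"
  then have fin: "finite ?O" "card ?O \<le> 2" by (auto simp: at_most_two_orbits_def)
  have T: "?T \<subseteq> carrier PSL2" using id_in_PSL2 LL_gens by (auto simp: carrier_GG intro!: moebius_in_PSL2)
  have "?v t \<in> half False" if "t \<in> ?T" for t
    using that T by (subst cs_in_half_iff) (auto simp: carrier_GG)
  then have v: "?v t \<in> VV" "?v t \<in> half False" if "t \<in> ?T" for t
    using that VV_halves by auto
  have "orbit (perm_group VV {k, l}) (\<lambda>h. h) C = {k C, l C}" for k l and C :: "'a elt set"
    by (auto simp: orbit_def)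
  then have orb: "orbit (perm_group (VV :: 'a elt set set) {\<one>\<^bsub>Sym VV\<^esub>, \<sigma>}) (\<lambda>h. h) (?v t) = {?v t, \<sigma> (?v t)}"
    if "t \<in> ?T" for t
    by (simp only: one_Sym restrict_apply v(1)[OF that] if_True)
  have disj: "half False \<inter> half True = ({} :: 'a elt set set)"
    by (auto simp: half_def dest: cs_snd)
  have "inj_on (\<lambda>t. {?v t, \<sigma> (?v t)}) ?T"
  proof (rule inj_onI)
    fix s t assume st: "s \<in> ?T" "t \<in> ?T" "{?v s, \<sigma> (?v s)} = {?v t, \<sigma> (?v t)}"
    have "\<sigma> (?v t) \<in> half True" using v(2)[OF st(2)] sigma_half by blast
    then have "?v s \<noteq> \<sigma> (?v t)" using v(2)[OF st(1)] disj by auto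
    moreover have "?v s \<in> {?v t, \<sigma> (?v t)}" using st(3) by blast
    ultimately have "?v s = ?v t" by blast
    then show "s = t" using cs_left_eq_iff[OF subsetD[OF T st(1)] subsetD[OF T st(2)]] by simp
  qed
  then have card_img: "card ((\<lambda>t. {?v t, \<sigma> (?v t)}) ` ?T) = card ?T" by (rule card_image)
  have sub: "(\<lambda>t. {?v t, \<sigma> (?v t)}) ` ?T \<subseteq> ?O"
    using orb v(1) unfolding orbits_def by blast
  have card_T: "card ?T = 3"
  proof -
    have "moebius 0 1 1 0 (Some 0) = (None :: 'a option)" "perm_b (Some 0) = Some (1::'a)"
      by (simp_all add: perm_b_def)
    then have "id \<noteq> (moebius 0 1 1 0 :: 'a option \<Rightarrow> 'a option)" "perm_b \<noteq> (moebius 0 1 1 0 :: 'a option \<Rightarrow> 'a option)"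
      by (metis id_apply option.distinct(1), metis option.distinct(1))
    then show ?thesis using perm_b_neq_id[where 'a = 'a] by (auto simp: card_insert_if)
  qed
  have "3 \<le> card ?O" using card_mono[OF fin(1) sub] unfolding card_img card_T .
  with fin(2) show False by linarith
qed

text \<open>Treats M and A together, with \<open>H\<close> the image of T^2 or of G. The obstruction
  in both is the central subgroup generated by \<sigma>, which is normal, nontrivial and has more
  than two orbits.\<close>

lemma sigma_extension:
  assumes H: "subgroup H (Sym VV)" "Gplus \<subseteq> H" "H \<subseteq> (Ghat :: ('a::field elt set \<Rightarrow> 'a elt set) set)"
  shows "transitive_perm_group VV (H <#>\<^bsub>Sym VV\<^esub> generate (Sym VV) {\<sigma>})"
    and "\<not> biquasiprimitive VV (H <#>\<^bsub>Sym VV\<^esub> generate (Sym VV) {\<sigma>})"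
proof -
  interpret H: subgroup H "Sym (VV :: 'a elt set set)" by fact
  let ?K = "H <#>\<^bsub>Sym VV\<^esub> {\<one>\<^bsub>Sym VV\<^esub>, \<sigma>}"
  have gen: "generate (Sym VV) {\<sigma>} = {\<one>\<^bsub>Sym VV\<^esub>, \<sigma> :: 'a elt set \<Rightarrow> 'a elt set}"
    by (rule rho.H.generate_involution[OF sigma_closed sigma_sigma])
  have central: "h \<otimes>\<^bsub>Sym VV\<^esub> \<sigma> = \<sigma> \<otimes>\<^bsub>Sym VV\<^esub> h" if "h \<in> H" for h
  proof -
    obtain x where "x \<in> carrier GG" "h = \<rho> x" using \<open>h \<in> H\<close> H(3) unfolding Ghat_def by blast
    then show ?thesis by (simp add: sigma_central)
  qed
  note K = rho.H.central_involution[OF H(1) sigma_closed sigma_sigma central]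
  have "\<sigma> \<in> ?K" "H \<subseteq> ?K"
  proof -
    have "\<one>\<^bsub>Sym VV\<^esub> \<otimes>\<^bsub>Sym VV\<^esub> \<sigma> \<in> ?K" unfolding set_mult_def using H.one_closed by blast
    then show "\<sigma> \<in> ?K" using sigma_closed by simp
    have "h \<otimes>\<^bsub>Sym VV\<^esub> \<one>\<^bsub>Sym VV\<^esub> \<in> ?K" if "h \<in> H" for h unfolding set_mult_def using that by blast
    then show "H \<subseteq> ?K" using H.mem_carrier by auto
  qed
  then have "transitive VV ?K"
    using H(2) by (intro transitive_VV[OF _ _ sigma_half K(1)]) auto
  then show "transitive_perm_group VV (H <#>\<^bsub>Sym VV\<^esub> generate (Sym VV) {\<sigma>})"
    using K(1) by (simp add: transitive_perm_group_def gen)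
  have "\<sigma> \<noteq> \<one>\<^bsub>Sym (VV :: 'a elt set set)\<^esub>"
  proof
    assume "\<sigma> = \<one>\<^bsub>Sym (VV :: 'a elt set set)\<^esub>"
    from fun_cong[OF this, of "cs \<one>\<^bsub>GG\<^esub>"] have "cs \<pi> = cs (\<one>\<^bsub>GG\<^esub> :: 'a elt)"
      by (simp add: sigma_cs one_Sym)
    then show False using cs_snd[of \<pi> "\<one>\<^bsub>GG\<^esub>"] by (simp add: snd_pi snd_one_GG)
  qed
  then show "\<not> biquasiprimitive VV (H <#>\<^bsub>Sym VV\<^esub> generate (Sym VV) {\<sigma>})"
    using K(2) sigma_many_orbits by (auto simp: biquasiprimitive_def gen)
qed

text \<open>T x 1 is normal in T^2. On the half that contains L it takes L to the vertices L(t,1),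
  and L(1,s) is one of these only if (s,s) lies in L; the other half behaves alike with the
  coordinates exchanged.\<close>

lemma Gplus_half:
  assumes out: "\<exists>s\<in>carrier PSL2. ((s, s), False) \<notin> (LL :: 'a::field elt set)"
  shows "transitive_perm_group (half e :: 'a elt set set) (induced (half e) Gplus)"
    and "\<not> quasiprimitive (half e :: 'a elt set set) (induced (half e) Gplus)"
proof -
  let ?h = "\<lambda>x. restrict (twist x) (half e :: 'a elt set set)"
  interpret h: group_hom GG "Sym (half e :: 'a elt set set)" ?h by (rule twist_half_hom)
  have G: "induced (half e) Gplus = ?h ` T2"
    by (simp add: induced_def Gplus_def image_image twist_T2)
  show "transitive_perm_group (half e :: 'a elt set set) (induced (half e) Gplus)"
    using h.subgroup_img_is_subgroup[OF subgroup_T2] induced_Gplus_transitive[OF order_refl, where 'a = 'a and e = e]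
    unfolding transitive_perm_group_def G by blast
  define K :: "'a elt set" where "K = (\<lambda>t. ((t, id), False)) ` carrier PSL2"
  interpret T: group "GG\<lparr>carrier := T2 :: 'a elt set\<rparr>"
    by (rule GG.subgroup_imp_group[OF subgroup_T2])
  have inv_id: "inv\<^bsub>PSL2\<^esub> id = (id :: 'a option \<Rightarrow> 'a option)"
    using PSL2.inv_one by simp
  have "subgroup K GG"
    by (intro GG.subgroupI) (auto simp: K_def carrier_GG id_in_PSL2 inv_GG inv_id mult_GG comp_in_PSL2)
  then have K_sub: "subgroup K (GG\<lparr>carrier := T2\<rparr>)"
    by (rule GG.subgroup_incl[OF _ subgroup_T2]) (auto simp: K_def T2_eq carrier_GG)
  have "x \<otimes>\<^bsub>GG\<^esub> k \<otimes>\<^bsub>GG\<^esub> inv\<^bsub>GG\<^esub> x \<in> K" if "x \<in> T2" "k \<in> K" for x k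
  proof -
    obtain y z t where x: "x = ((y, z), False)" "y \<in> carrier PSL2" "z \<in> carrier PSL2"
      and k: "k = ((t, id), False)" "t \<in> carrier PSL2"
      using \<open>x \<in> T2\<close> \<open>k \<in> K\<close> by (auto simp: T2_eq carrier_GG K_def)
    have "inv\<^bsub>PSL2\<^esub> z \<circ> z = id" using PSL2.r_inv[OF x(3)] by simp
    then show ?thesis using x k by (simp add: K_def mult_GG inv_GG comp_in_PSL2 image_iff)
  qed
  then have "K \<lhd> GG\<lparr>carrier := T2\<rparr>"
    using K_sub by (simp add: T.normal_inv_iff GG.m_inv_consistent[OF subgroup_T2])
  then have normal: "?h ` K \<lhd> perm_group (half e) (induced (half e) Gplus)"
    using group_hom.normal_image[OF h.induced_group_hom[OF subgroup_T2]] by (simp add: G)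
  \<comment> \<open>A representative of a base vertex of the half: the identity or \<pi>, depending
    on \<open>e\<close>.\<close>
  define x0 :: "'a elt" where "x0 = ((id, id), e)"
  have x0: "x0 \<in> carrier GG" "cs x0 \<in> half e"
    by (simp_all add: x0_def carrier_GG id_in_PSL2 cs_in_half_iff)
  obtain s where s: "s \<in> carrier PSL2" "((s, s), False) \<notin> (LL :: 'a elt set)" using out by blast
  have K_carrier: "((t, id), False) \<in> carrier GG" if "t \<in> carrier PSL2" for t :: "'a option \<Rightarrow> 'a option"
    using that by (simp add: carrier_GG)
  have hK: "?h ((t, id), False) (cs x0) = cs (x0 \<otimes>\<^bsub>GG\<^esub> ((t, id), False))" if "t \<in> carrier PSL2" for t
    using that x0 by (simp add: twist_cs carrier_GG)
  have "?h ` K \<noteq> {\<one>\<^bsub>Sym (half e)\<^esub>}"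
  proof
    assume eq: "?h ` K = {\<one>\<^bsub>Sym (half e)\<^esub>}"
    have "?h ((perm_b, id), False) = \<one>\<^bsub>Sym (half e)\<^esub>" using eq by (auto simp: K_def)
    from fun_cong[OF this, of "cs x0"] have "cs (x0 \<otimes>\<^bsub>GG\<^esub> ((perm_b, id), False)) = cs x0"
      using hK[OF perm_b_closed] x0 by (simp add: one_Sym)
    then have "x0 \<otimes>\<^bsub>GG\<^esub> inv\<^bsub>GG\<^esub> (x0 \<otimes>\<^bsub>GG\<^esub> ((perm_b, id), False)) \<in> LL"
      using x0 K_carrier[OF perm_b_closed] by (subst (asm) cs_eq_iff) simp_all
    then have "inv\<^bsub>PSL2\<^esub> perm_b = (id :: 'a option \<Rightarrow> 'a option)"
      by (auto simp: x0_def mult_GG inv_GG inv_id comp_in_PSL2 elim!: LL_diag split: if_splits)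
    then show False using perm_b_neq_id PSL2.inv_inv[OF perm_b_closed] inv_id by metis
  qed
  moreover have "\<not> transitive (half e) (?h ` K)"
  proof
    have ts: "x0 \<otimes>\<^bsub>GG\<^esub> ((id, s), False) \<in> carrier GG" "cs (x0 \<otimes>\<^bsub>GG\<^esub> ((id, s), False)) \<in> half e"
      using x0 s by (simp_all add: cs_in_half_iff snd_mult_GG x0_def mult_GG carrier_GG)
    assume "transitive (half e) (?h ` K)"
    then have "\<exists>h\<in>?h ` K. h (cs x0) = cs (x0 \<otimes>\<^bsub>GG\<^esub> ((id, s), False))"
      using x0(2) ts(2) unfolding transitive_def by blast
    then obtain t where t: "t \<in> carrier PSL2" "?h ((t, id), False) (cs x0) = cs (x0 \<otimes>\<^bsub>GG\<^esub> ((id, s), False))"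
      unfolding K_def by blast
    then have "cs (x0 \<otimes>\<^bsub>GG\<^esub> ((t, id), False)) = cs (x0 \<otimes>\<^bsub>GG\<^esub> ((id, s), False))"
      using hK by simp
    then have "x0 \<otimes>\<^bsub>GG\<^esub> ((id, s), False) \<otimes>\<^bsub>GG\<^esub> inv\<^bsub>GG\<^esub> (x0 \<otimes>\<^bsub>GG\<^esub> ((t, id), False)) \<in> LL"
      using x0 K_carrier[OF t(1)] ts by (subst (asm) cs_eq_iff) simp_all
    then obtain z where z: "x0 \<otimes>\<^bsub>GG\<^esub> ((id, s), False) \<otimes>\<^bsub>GG\<^esub> inv\<^bsub>GG\<^esub> (x0 \<otimes>\<^bsub>GG\<^esub> ((t, id), False)) = ((z, z), False)"
      "((z, z), False) \<in> (LL :: 'a elt set)"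
      by (metis LL_diag)
    \<comment> \<open>One coordinate is s and the other the inverse of t; \<open>e\<close> decides
      only which of them comes first.\<close>
    then have "z = s"
      using t(1) s(1) by (simp add: x0_def mult_GG inv_GG inv_id split: if_splits)
    then show False using z(2) s(2) by simp
  qed
  ultimately show "\<not> quasiprimitive (half e :: 'a elt set set) (induced (half e) Gplus)"
    using normal by (auto simp: quasiprimitive_def)
qed

theorem proposition9p5:
  fixes f :: nat and \<alpha> :: "'a::{field,finite}"
  assumes "f \<ge> 3"
    and "card (UNIV :: 'a set) = 2 ^ f"
    and "Digraph_Component.connected (\<Gamma> \<alpha>)"
  shows "biquasiprimitive (verts (\<Gamma> \<alpha>)) Ghat
    \<and> (transitive_perm_group (verts (\<Gamma> \<alpha>)) MM \<and> \<not> biquasiprimitive (verts (\<Gamma> \<alpha>)) MM)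
    \<and> (transitive_perm_group (verts (\<Gamma> \<alpha>)) AA \<and> \<not> biquasiprimitive (verts (\<Gamma> \<alpha>)) AA)
    \<and> (\<forall>\<Delta>\<in>(halves :: 'a elt set set set). quasiprimitive \<Delta> (induced \<Delta> Aplus))
    \<and> (\<forall>\<Delta>\<in>(halves :: 'a elt set set set).
         transitive_perm_group \<Delta> (induced \<Delta> Gplus) \<and> \<not> quasiprimitive \<Delta> (induced \<Delta> Gplus))"
proof -
  \<comment> \<open>The field order 2^f vanishes in the field, and therefore 2 does as well.\<close>
  have "of_nat (card (UNIV :: 'a set)) = (0::'a)"
    using CHAR_dvd_CARD[where 'a = 'a] by (simp add: of_nat_eq_0_iff_char_dvd)
  then have two: "(2::'a) = 0" using assms(2) by simp
  then have double: "x + x = 0" for x :: 'a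
    using mult_2[of x] by simp
  \<comment> \<open>Squaring is additive in characteristic 2, hence injective, and finiteness turns
    this into the existence of square roots.\<close>
  have "inj (\<lambda>x::'a. x\<^sup>2)"
  proof (rule injI)
    fix x y :: 'a assume "x\<^sup>2 = y\<^sup>2"
    then have "(x + y)\<^sup>2 = 0" using double[of "y\<^sup>2"] two by (simp add: power2_sum)
    then have "x + y = y + y" using double[of y] by simp
    then show "x = y" by simp
  qed
  then have "surj (\<lambda>x::'a. x\<^sup>2)" by (rule finite_UNIV_inj_surj[OF finite])
  then have sq: "\<exists>y. y\<^sup>2 = x" for x :: 'a by (metis surjD)
  \<comment> \<open>At least 8 elements leave room for \<kappa> besides 0 and 1; injectivity of
    squaring then excludes \<open>\<kappa>\<^sup>2 = 1\<close>.\<close>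
  have "(2::nat) ^ 3 \<le> 2 ^ f" using assms(1) by (intro power_increasing) auto
  then have "card (UNIV :: 'a set) \<noteq> card {0, 1::'a}" using assms(2) by simp
  then have "UNIV \<noteq> {0, 1::'a}" by metis
  then obtain \<kappa> :: 'a where \<kappa>: "\<kappa> \<noteq> 0" "\<kappa> \<noteq> 1" by blast
  then have "\<kappa>\<^sup>2 \<noteq> 1" using \<open>inj (\<lambda>x::'a. x\<^sup>2)\<close> by (metis injD one_power2)
  with sq \<kappa>(1) have simple: "simple_group (PSL2 :: ('a option \<Rightarrow> 'a option) monoid)"
    by (rule simple_PSL2)
  have verts: "verts (\<Gamma> \<alpha>) = VV" by (simp add: \<Gamma>_def Cos_def VV_def)
  have "Gplus \<subseteq> (Ghat :: ('a elt set \<Rightarrow> 'a elt set) set)" by (auto simp: Gplus_def Ghat_def T2_eq)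
  moreover have "subgroup Gplus (Sym (VV :: 'a elt set set))"
    unfolding Gplus_def by (rule rho.subgroup_img_is_subgroup[OF subgroup_T2])
  moreover have "subgroup Ghat (Sym (VV :: 'a elt set set))"
    unfolding Ghat_def by (rule rho.img_is_subgroup)
  ultimately have ext: "transitive_perm_group (VV :: 'a elt set set) MM" "\<not> biquasiprimitive (VV :: 'a elt set set) MM"
    "transitive_perm_group (VV :: 'a elt set set) AA" "\<not> biquasiprimitive (VV :: 'a elt set set) AA"
    unfolding MM_def AA_def by (intro sigma_extension; simp)+
  have halves: "\<forall>\<Delta>\<in>halves. P \<Delta>" if "\<And>e. P (half e)" for P :: "'a elt set set \<Rightarrow> bool"
    using that by (auto simp: halves_eq)
  show ?thesis
    unfolding verts
    by (intro conjI halves Ghat_biquasiprimitive Aplus_quasiprimitive simple ext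
        Gplus_half LL_proper[OF two \<kappa>])
qed

end
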